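(* Let $p\in\mathbb{N}$, $-\infty<a<\infty$, $b>0$, and let $g_p(x)=((x-a)^2+b^2)^{-p}$. Let $\operatorname{R}_n[g_p]$ denote the remainder when using the $n$-point Gauss-Legendre rule to compute $\int_{-1}^1 g_p(x)\,\mathrm{d}x$. Then, in the asymptotic limit $n\to\infty$, $$|\operatorname{R}_n[g_p]| \simeq \frac{2}{(p-1)!\,(2b)^p}\times\begin{cases}\left|\operatorname{Im}\left[k_n^{(p-1)}(z_0)\right]\right| & \text{if } p \text{ is odd},\\[4pt] \left|\operatorname{Re}\left[k_n^{(p-1)}(z_0)\right]\right| & \text{if } p \text{ is even},\end{cases}$$ where $z_0=a+ib$, $k_n$ is the remainder function of the $n$-point Gauss-Legendre rule, and its derivatives satisfy $$k_n^{(q)}(z)\simeq\left(-\frac{2n+1}{\sqrt{z^2-1}}\right)^q\frac{2\pi}{(z+\sqrt{z^2-1})^{2n+1}}.$$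
   Context: $\mathbb{N}=\{1,2,3,\dots\}$. The notation $a(n)\simeq b(n)$ means asymptotically equal: $\lim_{n\to\infty} a(n)/b(n)=1$. The $n$-point Gauss-Legendre rule on $[-1,1]$ is $\operatorname{Q}_n[f]=\sum_{i=1}^n f(x_i)w_i$, where $x_1<\dots<x_n$ are the roots of the Legendre polynomial $P_n$ of degree $n$ and $w_i=\frac{2}{(1-x_i^2)P_n'(x_i)^2}$. The remainder is $\operatorname{R}_n[f]=\int_{-1}^1 f(x)\,\mathrm{d}x-\operatorname{Q}_n[f]$. The remainder function of the rule is $$k_n(z)=\frac{1}{P_n(z)}\int_{-1}^1\frac{P_n(t)}{z-t}\,\mathrm{d}t,\qquad z\in\mathbb{C}\setminus[-1,1],$$ and $k_n^{(q)}$ denotes its $q$th derivative in $z$, for $q=0,1,2,\dots$. The square root $\sqrt{z^2-1}$ for $z\in\mathbb{C}\setminus[-1,1]$ denotes the branch analytic on $\mathbb{C}\setminus[-1,1]$ for which $|z+\sqrt{z^2-1}|>1$ (equivalently $\sqrt{z^2-1}\sim z$ as $|z|\to\infty$).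
   Formalization: For p≥2 and a≠0 the remainder asymptotics can fail (p=2, a=3√6/8, b=√2/8, n=3m: quotient tends to 2); there it is proved along those n→∞ for which |k_n^{(p-1)}(z_0)|/n is negligible against the Re/Im part taken. *)

theory Defs
  imports
    "HOL-Analysis.Analysis"
    "HOL-Computational_Algebra.Polynomial"
    "HOL-Library.Landau_Symbols"
begin

text \<open>Rodrigues' formula: \<open>P\<^sub>n(x) = (1 / (2\<^sup>n n!)) (d/dx)\<^sup>n (x\<^sup>2 - 1)\<^sup>n\<close>.\<close>

definition legendre :: "nat \<Rightarrow> real poly" where
  "legendre n = smult (1 / (2 ^ n * fact n)) ((pderiv ^^ n) ([:-1, 0, 1:] ^ n))"

text \<open>The roots of \<open>P\<^sub>n\<close> are real and simple, so the \<open>n\<close>-point rule is a sum over the set of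
  real roots.\<close>

definition gl_weight :: "nat \<Rightarrow> real \<Rightarrow> real" where
  "gl_weight n x = 2 / ((1 - x\<^sup>2) * (poly (pderiv (legendre n)) x)\<^sup>2)"

definition gl_rule :: "nat \<Rightarrow> (real \<Rightarrow> real) \<Rightarrow> real" where
  "gl_rule n f = (\<Sum>x | poly (legendre n) x = 0. f x * gl_weight n x)"

definition gl_remainder :: "nat \<Rightarrow> (real \<Rightarrow> real) \<Rightarrow> real" where
  "gl_remainder n f = integral {-1..1} f - gl_rule n f"

text \<open>Only meaningful off the segment \<open>[-1, 1]\<close>, where it is holomorphic; that set is open, so its
  iterated \<^const>\<open>deriv\<close> there does not depend on the values on the segment.\<close>

definition gl_rem_fun :: "nat \<Rightarrow> complex \<Rightarrow> complex" where
  "gl_rem_fun n z = 1 / poly (map_poly complex_of_real (legendre n)) z *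
     integral {-1..1} (\<lambda>t::real. complex_of_real (poly (legendre n) t) / (z - complex_of_real t))"

text \<open>The branch of \<open>\<surd>(z\<^sup>2 - 1)\<close> on the complement of \<open>[-1, 1]\<close> with \<open>|z + \<surd>(z\<^sup>2 - 1)| > 1\<close>; the
  condition on the modulus determines the root pointwise, as the following lemma shows.\<close>

definition sqrt_branch :: "complex \<Rightarrow> complex" where
  "sqrt_branch z = (THE s. s\<^sup>2 = z\<^sup>2 - 1 \<and> 1 < norm (z + s))"

lemma sqrt_branch_ex1:
  assumes "z \<notin> closed_segment (-1) (1::complex)"
  shows "\<exists>!s. s\<^sup>2 = z\<^sup>2 - 1 \<and> 1 < norm (z + s)"
proof -
  have prod1: "norm (z + s) * norm (z - s) = 1" if "s\<^sup>2 = z\<^sup>2 - 1" for s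
  proof -
    have "(z + s) * (z - s) = 1"
      using that by (simp add: algebra_simps power2_eq_square)
    then show ?thesis by (metis norm_mult norm_one)
  qed
  have ne1: "norm (z + s) \<noteq> 1" if s: "s\<^sup>2 = z\<^sup>2 - 1" for s
  proof
    assume n1: "norm (z + s) = 1"
    have "(z + s) * (z - s) = 1"
      using s by (simp add: algebra_simps power2_eq_square)
    moreover have "(z + s) * cnj (z + s) = 1"
      using n1 by (simp only: complex_norm_square [symmetric]) simp
    ultimately have "z - s = cnj (z + s)"
      by (metis mult_cancel_left mult_zero_left zero_neq_one)
    then have "2 * z = (z + s) + cnj (z + s)" by (simp add: algebra_simps)
    also have "\<dots> = complex_of_real (2 * Re (z + s))" by (rule complex_add_cnj)
    finally have "2 * z = 2 * complex_of_real (Re (z + s))" by simp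
    then have z: "z = complex_of_real (Re (z + s))"
      by (metis mult_cancel_left zero_neq_numeral)
    have "\<bar>Re (z + s)\<bar> \<le> 1" using n1 abs_Re_le_cmod [of "z + s"] by simp
    then have "Re (z + s) \<in> closed_segment (-1) (1::real)"
      by (auto simp: closed_segment_eq_real_ivl)
    then have "complex_of_real (Re (z + s)) \<in> closed_segment (of_real (-1)) (of_real 1)"
      by (simp only: of_real_closed_segment)
    then show False using z assms by simp
  qed
  define s where "s = csqrt (z\<^sup>2 - 1)"
  have s: "s\<^sup>2 = z\<^sup>2 - 1" "(- s)\<^sup>2 = z\<^sup>2 - 1" by (simp_all add: s_def)
  have ex: "\<exists>s. s\<^sup>2 = z\<^sup>2 - 1 \<and> 1 < norm (z + s)"
  proof (cases "1 < norm (z + s)")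
    case False
    then have lt: "norm (z + s) < 1" using ne1 [OF s(1)] by simp
    have "1 < norm (z - s)"
    proof (rule ccontr)
      assume "\<not> 1 < norm (z - s)"
      then have "norm (z + s) * norm (z - s) \<le> norm (z + s) * 1"
        by (intro mult_left_mono) auto
      then show False using prod1 [OF s(1)] lt by simp
    qed
    then show ?thesis using s(2) by (intro exI [of _ "- s"]) simp
  qed (use s in blast)
  moreover have "u = v"
    if u: "u\<^sup>2 = z\<^sup>2 - 1" "1 < norm (z + u)" and v: "v\<^sup>2 = z\<^sup>2 - 1" "1 < norm (z + v)" for u v
  proof (rule ccontr)
    assume "u \<noteq> v"
    then have "v = - u" using u(1) v(1) power2_eq_iff [of v u] by auto
    then have "1 < norm (z - u)" using v(2) by simp
    then have "1 < norm (z + u) * norm (z - u)"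
      using u(2) by (meson less_1_mult)
    then show False using prod1 [OF u(1)] by simp
  qed
  ultimately show ?thesis by blast
qed

definition gl_part :: "nat \<Rightarrow> complex \<Rightarrow> real" where
  "gl_part p w = (if odd p then \<bar>Im w\<bar> else \<bar>Re w\<bar>)"

text \<open>
  Pitfall. Write \<open>z\<^sub>0 = a + ib\<close>, \<open>K\<^sub>n = k\<^sub>n\<^sup>(\<^sup>p\<^sup>-\<^sup>1\<^sup>)(z\<^sub>0)\<close> with \<open>k\<^sub>n\<close> = \<^const>\<open>gl_rem_fun\<close>, and \<open>g\<^sub>p(x) = ((x - a)\<^sup>2 + b\<^sup>2)\<^sup>-\<^sup>p\<close>.
  Taking residues, the remainder of \<open>g\<^sub>p\<close> is, up to sign, \<open>2 / ((p-1)! (2b)\<^sup>p)\<close> times the imaginary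
  (\<open>p\<close> odd) or real (\<open>p\<close> even) part of \<open>K\<^sub>n (1 + c\<^sub>n)\<close>, where \<open>c\<^sub>n = 0\<close> if \<open>p = 1\<close>, and \<open>n c\<^sub>n\<close> tends to
  a limit that is non-real if \<open>p \<ge> 2\<close> and \<open>a \<noteq> 0\<close>. As \<open>n\<close> grows, the phase of \<open>K\<^sub>n\<close> rotates. If
  \<open>p \<ge> 2\<close> and \<open>a \<noteq> 0\<close>, its imaginary (real) part may be as small as \<open>|K\<^sub>n| / n\<close> for infinitely many
  \<open>n\<close>, and there the quotient of the remainder and the leading term need not tend to 1: for
  \<open>p = 2\<close>, \<open>a = 3 \<surd>6 / 8\<close>, \<open>b = \<surd>2 / 8\<close> and \<open>n = 3m\<close> it tends to 2. So for \<open>p \<ge> 2\<close> and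
  \<open>a \<noteq> 0\<close> the asymptotic equality is claimed along every filter of indices going to infinity for which
  \<open>|K\<^sub>n| / n\<close> is negligible relative to \<^const>\<open>gl_part\<close> of \<open>K\<^sub>n\<close>. Where this holds as
  \<open>n\<close> runs through all indices, that filter may be \<^const>\<open>sequentially\<close>.\<close>

end

theory Submission
  imports Defs "HOL-Complex_Analysis.Complex_Analysis"
begin

text \<open>
  The whole argument rests on one identity: the rule integrates the Cauchy kernel
  \<open>1 / (z - x)\<close> with remainder exactly \<open>k\<^sub>n(z)\<close> (\<open>gl_rem_fun_eq_remainder\<close>). Differentiating it
  \<open>q\<close> times in \<open>z\<close> gives the remainder of \<open>(-1)\<^sup>q q! / (z - x)\<^sup>q\<^sup>+\<^sup>1\<close>, and the partial fraction
  expansion of \<open>g\<^sub>p\<close> at its conjugate poles \<open>z\<^sub>0\<close> and \<open>cnj z\<^sub>0\<close> then expresses the remainder of \<open>g\<^sub>p\<close> as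
  the real part of a combination of \<open>k\<^sub>n(z\<^sub>0), ..., k\<^sub>n\<^sup>(\<^sup>p\<^sup>-\<^sup>1\<^sup>)(z\<^sub>0)\<close>, with leading coefficient
  \<open>2 / ((p-1)! (2ib)\<^sup>p)\<close> up to sign (\<open>gl_remainder_expansion\<close>). Division by \<open>i\<^sup>p\<close> is what selects
  the imaginary part for odd and the real part for even \<open>p\<close>.

  The asymptotics of \<open>k\<^sub>n\<close> come from the variable \<open>u = z + \<surd>(z\<^sup>2 - 1)\<close>, so that
  \<open>z = (u + 1/u) / 2\<close> with \<open>|u| > 1\<close>. In this variable
  \<open>P\<^sub>n(z) = \<Sum>\<^sub>k c\<^sub>k c\<^sub>n\<^sub>-\<^sub>k u\<^sup>n\<^sup>-\<^sup>2\<^sup>k\<close> with \<open>c\<^sub>k = binom(2k, k) / 4\<^sup>k\<close>, whence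
  \<open>P\<^sub>n(z) / (c\<^sub>n u\<^sup>n)\<close> tends to \<open>(1 - u\<^sup>-\<^sup>2)\<^sup>-\<^sup>1\<^sup>/\<^sup>2\<close> uniformly on \<open>|u| \<ge> \<rho> > 1\<close>
  (\<open>legendre_factor_uniform_limit\<close>). The numerator of \<open>k\<^sub>n\<close> satisfies the same three-term recurrence
  as \<open>P\<^sub>n\<close>; the Casoratian of the two solutions is constant, and this gives
  \<open>k\<^sub>n - k\<^sub>n\<^sub>+\<^sub>1 = 2 / ((n+1) P\<^sub>n P\<^sub>n\<^sub>+\<^sub>1)\<close> (\<open>gl_rem_fun_diff\<close>). Since \<open>k\<^sub>n\<close> tends to \<open>0\<close>, it is the sum
  of these differences, which behave like a geometric series in \<open>u\<^sup>-\<^sup>2\<close>; with Wallis' product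
  for \<open>c\<^sub>n\<^sup>2\<close> the sum is \<open>2 \<pi> u\<^sup>-\<^sup>2\<^sup>n\<^sup>-\<^sup>1 (1 + o(1))\<close>, locally uniformly in \<open>z\<close>
  (\<open>scaled_gl_rem_fun_locally_uniform\<close>). Locally uniform limits of holomorphic functions may be
  differentiated, and each derivative of \<open>u\<^sup>-\<^sup>2\<^sup>n\<^sup>-\<^sup>1\<close> contributes a factor
  \<open>- (2n+1) / \<surd>(z\<^sup>2 - 1)\<close> (\<open>higher_deriv_exponential_asymptotics\<close>).

  In particular each derivative is larger than the preceding one by a factor of order \<open>n\<close>. Hence the
  terms of the expansion below the leading one are \<open>O(|K\<^sub>n| / n)\<close> with \<open>K\<^sub>n = k\<^sub>n\<^sup>(\<^sup>p\<^sup>-\<^sup>1\<^sup>)(z\<^sub>0)\<close>, which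
  the hypothesis on the filter makes negligible. For \<open>p = 1\<close> there are none, and
  for \<open>a = 0\<close> the leading term of \<open>K\<^sub>n / i\<^sup>p\<close> is real, so that the real part of \<open>K\<^sub>n / i\<^sup>p\<close> has the
  size of \<open>K\<^sub>n\<close> itself.
\<close>

section \<open>Legendre polynomials from the formula of Rodrigues\<close>

definition leg_base :: "nat \<Rightarrow> real poly" where
  "leg_base n = smult (1 / (2 ^ n * fact n)) ([:-1, 0, 1:] ^ n)"

lemma legendre_eq_higher_pderiv: "legendre n = (pderiv ^^ n) (leg_base n)"
  by (simp add: legendre_def leg_base_def higher_pderiv_smult)

lemma leg_base_Suc: "[:-1, 0, 1:] * leg_base n = smult (2 * real (Suc n)) (leg_base (Suc n))"
proof -
  have "1 / (2 ^ n * fact n) = 2 * real (Suc n) * (1 / (2 ^ Suc n * fact (Suc n)) :: real)"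
    by (simp add: divide_simps)
  then show ?thesis
    by (simp only: leg_base_def mult_smult_right smult_smult power_Suc)
qed

lemma pderiv_leg_base: "pderiv (leg_base (Suc n)) = [:0, 1:] * leg_base n"
proof -
  have "pderiv [:-1, 0, 1 :: real:] = smult 2 [:0, 1:]" by (simp add: pderiv_pCons)
  then show ?thesis
    by (simp add: leg_base_def pderiv_smult pderiv_power_Suc field_simps
        del: mult_pCons_left mult_pCons_right smult_pCons of_nat_Suc power_Suc)
       (simp add: field_simps del: mult_pCons_left mult_pCons_right smult_pCons)
qed

lemma pderiv_pderiv_leg_base:
  "pderiv (pderiv (leg_base (Suc (Suc n)))) =
     smult (2 * real n + 3) (leg_base (Suc n)) + leg_base n"
proof -
  have sq: "[:0, 1:] * ([:0, 1:] * q) = [:-1, 0, 1:] * q + (q :: real poly)" for q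
    by (simp add: algebra_simps)
  have "pderiv (pderiv (leg_base (Suc (Suc n)))) =
      leg_base (Suc n) + [:0, 1:] * ([:0, 1:] * leg_base n)"
    by (simp add: pderiv_leg_base pderiv_mult pderiv_pCons del: mult_pCons_left mult_pCons_right)
  also have "\<dots> = leg_base (Suc n) + smult (2 * real (Suc n)) (leg_base (Suc n)) + leg_base n"
    by (simp only: sq leg_base_Suc add.assoc)
  also have "\<dots> = smult (2 * real n + 3) (leg_base (Suc n)) + leg_base n"
    by (intro poly_eqI) (simp add: algebra_simps)
  finally show ?thesis .
qed

lemma higher_pderiv_X_mult:
  "(pderiv ^^ Suc k) ([:0, 1:] * q) =
     [:0, 1:] * (pderiv ^^ Suc k) q + smult (of_nat (Suc k)) ((pderiv ^^ k) q)"
proof (induction k)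
  case 0
  then show ?case by (simp add: pderiv_mult pderiv_pCons algebra_simps)
next
  case (Suc k)
  have "(pderiv ^^ Suc (Suc k)) ([:0, 1:] * q) = pderiv ((pderiv ^^ Suc k) ([:0, 1:] * q))"
    by simp
  also have "\<dots> = [:0, 1:] * (pderiv ^^ Suc (Suc k)) q + (pderiv ^^ Suc k) q
      + smult (of_nat (Suc k)) ((pderiv ^^ Suc k) q)"
    unfolding Suc.IH
    by (simp add: pderiv_mult pderiv_add pderiv_smult pderiv_pCons algebra_simps del: of_nat_Suc)
  finally show ?case by (simp add: algebra_simps smult_add_left)
qed

text \<open>
  Both \<open>P\<^sub>n\<^sub>+\<^sub>2 - x P\<^sub>n\<^sub>+\<^sub>1\<close> and \<open>P\<^sub>n\<^sub>+\<^sub>2 - P\<^sub>n\<close> are multiples of the \<open>n\<close>-th derivative \<open>M\<close> of a multiple of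
  \<open>(x\<^sup>2 - 1)\<^sup>n\<^sup>+\<^sup>1\<close>: the first because one derivative of the base polynomial produces a factor \<open>x\<close>, the
  second because two derivatives reproduce the two preceding base polynomials. Eliminating \<open>M\<close> gives
  the recurrence.
\<close>
lemma legendre_recurrence:
  "smult (real n + 2) (legendre (Suc (Suc n))) =
     smult (2 * real n + 3) ([:0, 1:] * legendre (Suc n)) - smult (real n + 1) (legendre n)"
proof -
  define M where "M = (pderiv ^^ n) (leg_base (Suc n))"
  have 1: "legendre (Suc (Suc n)) = [:0, 1:] * legendre (Suc n) + smult (real n + 1) M"
    unfolding legendre_eq_higher_pderiv M_def
    by (subst funpow_Suc_right)
       (simp add: pderiv_leg_base higher_pderiv_X_mult
         del: funpow.simps mult_pCons_left mult_pCons_right, simp add: add.commute)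
  have 2: "legendre (Suc (Suc n)) = smult (2 * real n + 3) M + legendre n"
    unfolding legendre_eq_higher_pderiv M_def
    by (simp add: funpow_Suc_right pderiv_pderiv_leg_base higher_pderiv_add higher_pderiv_smult
         del: funpow.simps)
  have "smult (real n + 2) (legendre (Suc (Suc n))) =
      smult (2 * real n + 3) (legendre (Suc (Suc n))) - smult (real n + 1) (legendre (Suc (Suc n)))"
    by (simp flip: smult_diff_left)
  also have "\<dots> = smult (2 * real n + 3) ([:0, 1:] * legendre (Suc n) + smult (real n + 1) M)
       - smult (real n + 1) (smult (2 * real n + 3) M + legendre n)"
    by (subst 1[symmetric], subst 2[symmetric]) (rule refl)
  finally show ?thesis
    by (simp add: smult_add_right mult.commute del: mult_pCons_left mult_pCons_right)
qed

lemma legendre_0 [simp]: "legendre 0 = 1"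
  by (simp add: legendre_def)

lemma legendre_1 [simp]: "legendre (Suc 0) = [:0, 1:]"
  by (simp add: legendre_def pderiv_pCons)

lemma poly_legendre_recurrence:
  "(real n + 2) * poly (legendre (Suc (Suc n))) x =
     (2 * real n + 3) * x * poly (legendre (Suc n)) x - (real n + 1) * poly (legendre n) x"
  using arg_cong[OF legendre_recurrence[of n], of "\<lambda>p. poly p x"] by (simp add: algebra_simps)

lemma poly_legendre_one [simp]: "poly (legendre n) 1 = 1"
proof (induction n rule: induct_nat_012)
  case (ge2 n)
  then show ?case using poly_legendre_recurrence[of n 1] by simp
qed auto

lemma poly_legendre_minus_one: "poly (legendre n) (-1) = (-1) ^ n"
proof (induction n rule: induct_nat_012)
  case (ge2 n)
  have "(real n + 2) * poly (legendre (Suc (Suc n))) (-1) = (real n + 2) * (-1) ^ n"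
    using poly_legendre_recurrence[of n "-1"] ge2 by (simp add: algebra_simps)
  then show ?case by simp
qed auto

lemma legendre_nonzero [simp]: "legendre n \<noteq> 0"
  using poly_legendre_one[of n] by fastforce

lemma degree_higher_pderiv: "degree ((pderiv ^^ k) (p :: real poly)) = degree p - k"
  by (induction k) (auto simp: degree_pderiv)

lemma degree_legendre [simp]: "degree (legendre n) = n"
  by (simp add: legendre_def degree_higher_pderiv degree_power_eq)

text \<open>
  A derivative lowers the multiplicity of a zero by at most one. Applied to \<open>(x\<^sup>2 - 1)\<^sup>n\<close> it makes
  all derivatives of order below \<open>n\<close> vanish at \<open>1\<close> and \<open>-1\<close>, which removes the boundary terms from
  the integrations by parts and supplies the end points for Rolle's theorem.
\<close>
lemma power_dvd_pderiv:
  assumes "p ^ Suc m dvd q"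
  shows "p ^ m dvd pderiv (q :: real poly)"
proof -
  from assms obtain r where "q = p ^ Suc m * r" by (rule dvdE)
  then have "pderiv q = p ^ m * (p * pderiv r + smult (of_nat (Suc m)) (r * pderiv p))"
    by (simp add: pderiv_mult pderiv_power_Suc algebra_simps del: of_nat_Suc power_Suc)
       (simp add: algebra_simps del: of_nat_Suc)
  then show ?thesis by simp
qed

lemma leg_base_derivative_endpoint:
  assumes "k < n" "x\<^sup>2 = 1"
  shows "poly ((pderiv ^^ k) (leg_base n)) x = 0"
proof -
  have "[:-1, 0, 1:] ^ (n - k) dvd (pderiv ^^ k) (leg_base n)" using \<open>k < n\<close>
  proof (induction k)
    case 0
    then show ?case by (simp add: leg_base_def dvd_smult)
  next
    case (Suc k)
    then show ?case
      using power_dvd_pderiv[of "[:-1, 0, 1:]" "n - Suc k" "(pderiv ^^ k) (leg_base n)"]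
      by (simp add: Suc_diff_Suc)
  qed
  then have "[:-1, 0, 1:] dvd (pderiv ^^ k) (leg_base n)"
    using \<open>k < n\<close> by (meson dvd_power dvd_trans zero_less_diff)
  then obtain r where r: "(pderiv ^^ k) (leg_base n) = [:-1, 0, 1:] * r" by (rule dvdE)
  show ?thesis using assms(2) unfolding r by (simp add: power2_eq_square algebra_simps)
qed

section \<open>Orthogonality and zeros\<close>

lemma poly_integrable: "(\<lambda>x::real. poly p x) integrable_on {a..b}"
  by (intro integrable_continuous_real continuous_intros)

lemma integral_pderiv:
  "integral {-1..1} (\<lambda>t. poly (pderiv p) t) = poly p 1 - poly p (-1 :: real)"
proof (rule integral_unique, rule fundamental_theorem_of_calculus)
  show "(poly p has_vector_derivative poly (pderiv p) x) (at x within {-1..1})" for x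
    by (intro has_real_derivative_iff_has_vector_derivative[THEN iffD1] DERIV_subset[OF poly_DERIV])
        auto
qed simp

lemma integral_pderiv_mult:
  "integral {-1..1} (\<lambda>t. poly (pderiv p) t * poly q t) =
     poly p 1 * poly q 1 - poly p (-1) * poly q (-1 :: real)
     - integral {-1..1} (\<lambda>t. poly p t * poly (pderiv q) t)"
proof -
  have "integral {-1..1} (\<lambda>t. poly (pderiv (p * q)) t) =
     integral {-1..1} (\<lambda>t. poly (pderiv p * q) t + poly (p * pderiv q) t)"
    by (simp add: pderiv_mult algebra_simps)
  also have "\<dots> = integral {-1..1} (\<lambda>t. poly (pderiv p * q) t) + integral {-1..1} (\<lambda>t. poly (p *
      pderiv q) t)"
    by (rule integral_add) (intro poly_integrable)+
  finally show ?thesis using integral_pderiv[of "p * q"] by simp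
qed

text \<open>
  Integration by parts moves all \<open>n\<close> derivatives onto \<open>q\<close> and annihilates it. The degree
  condition is phrased through coefficients so that it is also true of \<open>q = 0\<close> when \<open>n = 0\<close>.
\<close>
lemma legendre_orthogonal:
  assumes "\<And>i. i \<ge> n \<Longrightarrow> coeff q i = 0"
  shows "integral {-1..1} (\<lambda>t. poly (legendre n) t * poly q t) = 0"
proof -
  have "integral {-1..1} (\<lambda>t. poly ((pderiv ^^ k) (leg_base n)) t * poly q t) = 0"
    if "k \<le> n" "\<And>i. i \<ge> k \<Longrightarrow> coeff q i = 0" for k q
    using that
  proof (induction k arbitrary: q)
    case 0
    then have "q = 0" by (intro poly_eqI) simp
    then show ?case by simp
  next
    case (Suc k)
    have "integral {-1..1} (\<lambda>t. poly ((pderiv ^^ k) (leg_base n)) t * poly (pderiv q) t) = 0"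
      using Suc.prems by (intro Suc.IH) (auto simp: coeff_pderiv)
    then show ?case
      using Suc.prems(1) by (simp add: integral_pderiv_mult leg_base_derivative_endpoint)
  qed
  from this[of n q] show ?thesis using assms by (simp add: legendre_eq_higher_pderiv)
qed

text \<open>
  Rolle's theorem between consecutive zeros. Induction adds a new largest zero \<open>b\<close>; the
  new zero of the derivative lies between \<open>b\<close> and the previous maximum, hence is not among those
  found before.
\<close>
lemma Rolle_poly_card:
  fixes p :: "real poly"
  assumes "finite B" "B \<noteq> {}" "\<And>x. x \<in> B \<Longrightarrow> poly p x = 0"
  shows "\<exists>C. finite C \<and> Suc (card C) = card B \<and> C \<subseteq> {Min B<..<Max B} \<and>
           (\<forall>x\<in>C. poly (pderiv p) x = 0)"
  using assms
proof (induction B rule: finite_linorder_max_induct)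
  case empty
  then show ?case by simp
next
  case (insert b B)
  show ?case
  proof (cases "B = {}")
    case True
    then show ?thesis by (intro exI[of _ "{}"]) auto
  next
    case False
    then obtain C where C: "finite C" "Suc (card C) = card B" "C \<subseteq> {Min B<..<Max B}"
        "\<forall>x\<in>C. poly (pderiv p) x = 0"
      using insert by auto
    have b: "Max B < b" using insert.hyps False by simp
    obtain c where c: "Max B < c" "c < b" "poly p b - poly p (Max B) = (b - Max B) * poly (pderiv p) c"
      using poly_MVT[OF b] by blast
    have "poly p (Max B) = 0" "poly p b = 0" using insert.prems insert.hyps False Max_in by auto
    then have c0: "poly (pderiv p) c = 0" using c b by simp
    have "b \<notin> B" and Bb: "\<And>x. x \<in> B \<Longrightarrow> x \<le> b" using insert.hyps by force+
    moreover have "Min B \<le> b" using False Bb Min_in[OF insert.hyps(1)] by simp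
    ultimately have Mb: "Max (insert b B) = b" "Min (insert b B) = Min B"
      using False b insert.hyps(1) by (simp_all add: max_absorb1 min_absorb2)
    have "c \<notin> C" "b \<notin> B" using C c insert.hyps by auto
    moreover have "Min B \<le> Max B" using False insert.hyps by simp
    ultimately show ?thesis
      unfolding Mb using C c c0 b insert.hyps by (intro exI[of _ "insert c C"]) auto
  qed
qed

text \<open>
  The \<open>k\<close>-th derivative of \<open>(x\<^sup>2 - 1)\<^sup>n\<close> has \<open>k\<close> interior zeros and, for \<open>k < n\<close>, also vanishes at
  both end points; Rolle's theorem on these \<open>k + 2\<close> points provides \<open>k + 1\<close> interior zeros of the next
  derivative.
\<close>
lemma legendre_roots_exist:
  "\<exists>A. finite A \<and> card A = n \<and> A \<subseteq> {-1<..<1} \<and> (\<forall>x\<in>A. poly (legendre n) x = 0)"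
proof -
  have "\<exists>A. finite A \<and> card A = k \<and> A \<subseteq> {-1<..<1} \<and> (\<forall>x\<in>A. poly ((pderiv ^^ k) (leg_base n)) x = 0)"
    if "k \<le> n" for k
    using that
  proof (induction k)
    case 0
    then show ?case by (intro exI[of _ "{}"]) auto
  next
    case (Suc k)
    from Suc.IH[OF Suc_leD[OF Suc.prems]] obtain A where A: "finite A" "card A = k" "A \<subseteq> {-1<..<1}"
        "\<forall>x\<in>A. poly ((pderiv ^^ k) (leg_base n)) x = 0"
      by blast
    define B where "B = insert (-1) (insert 1 A)"
    have B: "finite B" "card B = Suc (Suc k)" "B \<noteq> {}" using A by (auto simp: B_def card_insert_if)
    have Mm: "Min B = -1" "Max B = 1"
    proof -
      have "x < 1 \<and> -1 < x" if "x \<in> A" for x using A(3) that by auto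
      then have "\<forall>x\<in>B. -1 \<le> x \<and> x \<le> 1" by (auto simp: B_def less_imp_le)
      moreover have "-1 \<in> B" "1 \<in> B" by (auto simp: B_def)
      ultimately show "Min B = -1" "Max B = 1"
        using B(1) by (blast intro!: Min_eqI Max_eqI)+
    qed
    have "poly ((pderiv ^^ k) (leg_base n)) x = 0" if "x \<in> B" for x
    proof -
      have "x \<in> A \<or> x\<^sup>2 = 1" using that by (auto simp: B_def)
      then show ?thesis using A(4) leg_base_derivative_endpoint[of k n x] Suc.prems by auto
    qed
    from Rolle_poly_card[OF B(1,3) this] show ?case by (simp add: Mm B(2))
  qed
  from this[of n] show ?thesis by (simp add: legendre_eq_higher_pderiv)
qed

lemma legendre_roots:
  shows finite_legendre_roots: "finite {x. poly (legendre n) x = 0}"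
    and card_legendre_roots: "card {x. poly (legendre n) x = 0} = n"
    and legendre_roots_interior: "poly (legendre n) x = 0 \<Longrightarrow> \<bar>x\<bar> < 1"
proof -
  show fin: "finite {x. poly (legendre n) x = 0}" by (simp add: poly_roots_finite)
  obtain A where A: "finite A" "card A = n" "A \<subseteq> {-1<..<1}" "\<forall>x\<in>A. poly (legendre n) x = 0"
    using legendre_roots_exist by blast
  have "card {x. poly (legendre n) x = 0} \<le> n"
    using card_poly_roots_bound[of "legendre n"] by simp
  then have A_eq: "A = {x. poly (legendre n) x = 0}"
    using A fin by (intro card_seteq subsetI) simp_all
  show "card {x. poly (legendre n) x = 0} = n" using A(2) by (simp only: A_eq)
  show "\<bar>x\<bar> < 1" if "poly (legendre n) x = 0"
  proof -
    have "x \<in> {-1<..<1}" using that A(3) unfolding A_eq by blast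
    then show ?thesis by auto
  qed
qed

section \<open>Legendre polynomials in the Joukowski variable\<close>

abbreviation cpoly :: "real poly \<Rightarrow> complex \<Rightarrow> complex" where
  "cpoly p z \<equiv> poly (map_poly complex_of_real p) z"

lemma map_poly_of_real_mult:
  "map_poly complex_of_real (p * q) = map_poly complex_of_real p * map_poly complex_of_real q"
  by (intro poly_eqI) (simp add: coeff_map_poly coeff_mult)

lemma map_poly_of_real_add:
  "map_poly complex_of_real (p + q) = map_poly complex_of_real p + map_poly complex_of_real q"
  by (intro poly_eqI) (simp add: coeff_map_poly)

lemma map_poly_of_real_diff:
  "map_poly complex_of_real (p - q) = map_poly complex_of_real p - map_poly complex_of_real q"
  by (intro poly_eqI) (simp add: coeff_map_poly)

lemma map_poly_of_real_smult:
  "map_poly complex_of_real (smult c p) = smult (of_real c) (map_poly complex_of_real p)"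
  by (intro poly_eqI) (simp add: coeff_map_poly)

lemmas map_poly_of_real_hom =
  map_poly_of_real_mult map_poly_of_real_add map_poly_of_real_diff map_poly_of_real_smult

lemma cpoly_of_real: "cpoly p (of_real x) = of_real (poly p x)"
  by (induction p) (simp_all add: map_poly_pCons)

lemma cpoly_legendre_recurrence:
  "(of_nat n + 2) * cpoly (legendre (Suc (Suc n))) z =
     (2 * of_nat n + 3) * z * cpoly (legendre (Suc n)) z - (of_nat n + 1) * cpoly (legendre n) z"
  using arg_cong[OF legendre_recurrence[of n], of "\<lambda>p. cpoly p z"]
  by (simp add: map_poly_of_real_hom map_poly_pCons algebra_simps del: mult_pCons_left)

text \<open>
  The coefficients of \<open>(1 - x)\<^sup>-\<^sup>1\<^sup>/\<^sup>2\<close>, that is, \<open>binom(2k, k) / 4\<^sup>k\<close>.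
\<close>
primrec half_coeff :: "nat \<Rightarrow> real" where
  "half_coeff 0 = 1"
| "half_coeff (Suc k) = (2 * real k + 1) / (2 * real k + 2) * half_coeff k"

lemma half_coeff_pos [simp]: "half_coeff k > 0"
  by (induction k) auto

lemma half_coeff_nonneg [simp]: "half_coeff k \<ge> 0"
  using half_coeff_pos[of k] by linarith

lemma half_coeff_nonzero [simp]: "half_coeff k \<noteq> 0"
  using half_coeff_pos[of k] by linarith

text \<open>
  This bounds \<open>c\<^sub>k c\<^sub>n\<^sub>-\<^sub>k / c\<^sub>n\<close> by \<open>1\<close>, which is the domination needed for the passage to the limit in
  \<open>legendre_factor_uniform_limit\<close>.
\<close>
lemma half_coeff_mult_le: "half_coeff k * half_coeff m \<le> half_coeff (k + m)"
proof (induction m)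
  case (Suc m)
  have "half_coeff k * half_coeff (Suc m) =
      (2 * real m + 1) / (2 * real m + 2) * (half_coeff k * half_coeff m)"
    by simp
  also have "\<dots> \<le> (2 * real (k + m) + 1) / (2 * real (k + m) + 2) * half_coeff (k + m)"
    by (rule mult_mono) (use Suc in \<open>auto simp: field_simps\<close>)
  finally show ?case by simp
qed simp

lemma half_coeff_ratio: "(\<lambda>n. half_coeff n / half_coeff (n + k)) \<longlonglongrightarrow> 1"
proof (induction k)
  case (Suc k)
  have "(\<lambda>n. (2 * real (n + k) + 2) / (2 * real (n + k) + 1)) \<longlonglongrightarrow> 1"
    by real_asymp
  from tendsto_mult[OF Suc this] show ?case by (simp add: field_simps)
qed simp

text \<open>
  The expansion of \<open>(1 - v r)\<^sup>-\<^sup>1\<^sup>/\<^sup>2\<close> in powers of \<open>r\<close>. The product of the series for \<open>v\<close> and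
  for \<open>u = 1/v\<close> is \<open>(1 - 2 z r + r\<^sup>2)\<^sup>-\<^sup>1\<^sup>/\<^sup>2\<close> with \<open>z = (u + v) / 2\<close>, the generating function of the
  Legendre polynomials.
\<close>
definition joukowski_fps :: "complex \<Rightarrow> complex fps" where
  "joukowski_fps v = Abs_fps (\<lambda>k. of_real (half_coeff k) * v ^ k)"

text \<open>
  The differential equation \<open>(1 - v r) f' = (v / 2) f\<close>, arranged so that coefficients can be compared.
\<close>
lemma joukowski_fps_deriv:
  "fps_deriv (joukowski_fps v) =
     fps_const v * (fps_X * fps_deriv (joukowski_fps v)) + fps_const (v / 2) * joukowski_fps v"
proof (rule fps_ext)
  fix n
  have "(real n + 1) * half_coeff (Suc n) = (real n + 1 / 2) * half_coeff n"
    by (simp add: field_simps)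
  from arg_cong[OF this, of complex_of_real]
  have 1: "(of_nat n + 1) * complex_of_real (half_coeff (Suc n)) =
      (of_nat n + 1 / 2) * of_real (half_coeff n)"
    by (simp del: half_coeff.simps)
  have "fps_deriv (joukowski_fps v) $ n =
      (of_nat n + 1) * of_real (half_coeff (Suc n)) * v ^ Suc n"
    by (simp add: joukowski_fps_def add.commute del: half_coeff.simps)
  also have "\<dots> = v * (of_nat n * (of_real (half_coeff n) * v ^ n)) + v / 2 * (of_real (half_coeff n)
      * v ^ n)"
    unfolding 1 by (simp add: algebra_simps)
  also have "\<dots> = (fps_const v * (fps_X * fps_deriv (joukowski_fps v)) + fps_const (v / 2) *
      joukowski_fps v) $ n"
    by (cases n) (simp_all add: joukowski_fps_def add.commute del: half_coeff.simps)
  finally show "fps_deriv (joukowski_fps v) $ n =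
      (fps_const v * (fps_X * fps_deriv (joukowski_fps v)) + fps_const (v / 2) * joukowski_fps v) $ n" .
qed

text \<open>
  The product \<open>G\<close> satisfies \<open>(1 - v r) (1 - u r) G' = ((u + v) / 2 - u v r) G\<close> by the product rule; with
  \<open>u v = 1\<close> its coefficients obey the recurrence of the Legendre polynomials at \<open>(u + v) / 2\<close>.
\<close>
lemma half_coeff_convolution_recurrence:
  fixes u v :: complex
  defines "G \<equiv> joukowski_fps v * joukowski_fps u"
  assumes "u * v = 1"
  shows "(of_nat n + 2) * G $ Suc (Suc n) =
     (2 * of_nat n + 3) * ((u + v) / 2) * G $ Suc n - (of_nat n + 1) * G $ n"
proof -
  \<comment> \<open>The names keep the ideal membership below free of the particular series.\<close>
  define A B where "A = joukowski_fps v" and "B = joukowski_fps u"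
  have A: "fps_deriv A = fps_const v * (fps_X * fps_deriv A) + fps_const (v / 2) * A"
    and B: "fps_deriv B = fps_const u * (fps_X * fps_deriv B) + fps_const (u / 2) * B"
    unfolding A_def B_def by (rule joukowski_fps_deriv)+
  have uv: "fps_const u * fps_const v = 1" using assms(2) by simp
  have h: "fps_const (v / 2) = fps_const (1/2) * fps_const v"
      "fps_const (u / 2) = fps_const (1/2) * fps_const u"
    by simp_all
  have D: "fps_deriv G = (fps_const u + fps_const v) * (fps_X * fps_deriv G) - fps_X * (fps_X *
      fps_deriv G)
      + fps_const (1/2) * (fps_const u + fps_const v) * G - fps_X * G"
  proof -
    have two: "fps_const (1/2) * 2 = (1 :: complex fps)"
      by (metis fps_const_1_eq_1 fps_const_mult fps_numeral_fps_const nonzero_eq_divide_eq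
          one_add_one zero_neq_numeral)
    have G': "fps_deriv G = fps_deriv A * B + A * fps_deriv B" by (simp add: G_def A_def B_def)
    have GAB: "G = A * B" by (simp add: G_def A_def B_def)
    define A' B' where "A' = fps_deriv A" and "B' = fps_deriv B"
    define U V H where "U = fps_const u" and "V = fps_const v" and "H = fps_const (1 / 2 :: complex)"
    have "A' * B + A * B' = (U + V) * (fps_X * (A' * B + A * B'))
        - fps_X * (fps_X * (A' * B + A * B')) + H * (U + V) * (A * B) - fps_X * (A * B)"
      using A B uv two unfolding h A'_def[symmetric] B'_def[symmetric] U_def[symmetric]
        V_def[symmetric] H_def[symmetric]
      by algebra
    then show ?thesis
      by (simp only: G' GAB[symmetric] A'_def B'_def U_def V_def H_def)
  qed
  have "fps_deriv G $ Suc n = (fps_const (u + v) * (fps_X * fps_deriv G) - fps_X * (fps_X * fps_deriv G)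
      + fps_const ((u + v) / 2) * G - fps_X * G) $ Suc n"
    using D by (simp add: mult.commute)
  also have "\<dots> = (u + v) * (fps_X * fps_deriv G) $ Suc n - (fps_X * (fps_X * fps_deriv G)) $ Suc n
      + (u + v) / 2 * G $ Suc n - (fps_X * G) $ Suc n"
    by simp
  also have "(fps_X * fps_deriv G) $ Suc n = (of_nat n + 1) * G $ Suc n"
    by (simp add: add.commute)
  also have "(fps_X * (fps_X * fps_deriv G)) $ Suc n = of_nat n * G $ n"
    by (cases n) (simp_all add: add.commute)
  also have "(fps_X * G) $ Suc n = G $ n"
    by simp
  finally have "(of_nat n + 2) * G $ Suc (Suc n) = (u + v) * ((of_nat n + 1) * G $ Suc n) -
      of_nat n * G $ n + (u + v) / 2 * G $ Suc n - G $ n"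
    by (simp add: add.commute)
  then show ?thesis by (simp add: field_simps)
qed

lemma legendre_joukowski:
  assumes "u * v = 1"
  shows "cpoly (legendre n) ((u + v) / 2) =
           (\<Sum>k\<le>n. of_real (half_coeff k) * of_real (half_coeff (n - k)) * v ^ k * u ^ (n - k))"
proof -
  define G where "G = joukowski_fps v * joukowski_fps u"
  have "cpoly (legendre n) ((u + v) / 2) = G $ n"
  proof (induction n rule: induct_nat_012)
    case 0
    then show ?case by (simp add: G_def joukowski_fps_def)
  next
    case 1
    then show ?case by (simp add: G_def joukowski_fps_def fps_mult_nth map_poly_pCons field_simps)
  next
    case (ge2 n)
    have "(of_nat n + 2) * cpoly (legendre (Suc (Suc n))) ((u + v) / 2) =
        (of_nat n + 2) * G $ Suc (Suc n)"
      unfolding cpoly_legendre_recurrence ge2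
      using half_coeff_convolution_recurrence[OF assms, of n] by (simp add: G_def)
    moreover have "of_nat n + 2 \<noteq> (0 :: complex)"
      by (metis of_nat_add of_nat_numeral of_nat_eq_0_iff add_is_0 zero_neq_numeral)
    ultimately show ?case by simp
  qed
  then show ?thesis
    unfolding G_def fps_mult_nth by (simp add: joukowski_fps_def atLeast0AtMost mult_ac)
qed

text \<open>
  The case \<open>u = v = 1\<close> of the expansion, where \<open>P\<^sub>n(1) = 1\<close>. It says that the series
  \<open>\<Sum> c\<^sub>k x\<^sup>k\<close> has square \<open>1 / (1 - x)\<close>.
\<close>
lemma half_coeff_convolution: "(\<Sum>k\<le>n. half_coeff k * half_coeff (n - k)) = 1"
proof -
  have "complex_of_real (\<Sum>k\<le>n. half_coeff k * half_coeff (n - k)) = cpoly (legendre n) (of_real 1)"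
    using legendre_joukowski[of 1 1 n] by simp
  also have "\<dots> = of_real 1" unfolding cpoly_of_real by simp
  finally show ?thesis unfolding of_real_eq_iff .
qed

text \<open>
  On the segment \<open>t = (u + cnj u) / 2\<close> with \<open>|u| = 1\<close>, so the modulus of the expansion is at most the
  sum of its coefficients, which is \<open>1\<close>.
\<close>
lemma abs_legendre_le_1:
  assumes "\<bar>t\<bar> \<le> 1"
  shows "\<bar>poly (legendre n) t\<bar> \<le> 1"
proof -
  define u where "u = Complex t (sqrt (1 - t\<^sup>2))"
  have t2: "t\<^sup>2 \<le> 1" using assms by (simp add: abs_square_le_1)
  have n1: "norm u = 1" using t2 by (simp add: u_def cmod_def)
  then have uc: "u * cnj u = 1" by (simp add: complex_norm_square[symmetric])
  have "(u + cnj u) / 2 = of_real t" by (simp add: u_def complex_add_cnj)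
  then have "complex_of_real (poly (legendre n) t) = 
      (\<Sum>k\<le>n. of_real (half_coeff k) * of_real (half_coeff (n - k)) * cnj u ^ k * u ^ (n - k))"
    using legendre_joukowski[OF uc, of n] by (simp add: cpoly_of_real)
  then have "\<bar>poly (legendre n) t\<bar> = norm (\<Sum>k\<le>n. complex_of_real (half_coeff k) * of_real
      (half_coeff (n - k)) * cnj u ^ k * u ^ (n - k))"
    by (metis norm_of_real real_norm_def)
  also have "\<dots> \<le> (\<Sum>k\<le>n. half_coeff k * half_coeff (n - k))"
    by (intro sum_norm_le) (simp add: norm_mult norm_power n1)
  finally show ?thesis by (simp add: half_coeff_convolution)
qed

text \<open>
  With \<open>w = 1/u\<close>, this is \<open>P\<^sub>n(z) / (c\<^sub>n u\<^sup>n)\<close>; each coefficient tends to \<open>c\<^sub>k\<close> as \<open>n\<close> grows.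
\<close>
definition legendre_factor :: "nat \<Rightarrow> complex \<Rightarrow> complex" where
  "legendre_factor n w = (\<Sum>k\<le>n. of_real (half_coeff k * half_coeff (n - k) / half_coeff n) * w ^ (2
      * k))"

definition legendre_factor_lim :: "complex \<Rightarrow> complex" where
  "legendre_factor_lim w = (\<Sum>k. of_real (half_coeff k) * w ^ (2 * k))"

lemma legendre_eq_factor:
  assumes "u * w = 1"
  shows "cpoly (legendre n) ((u + w) / 2) = of_real (half_coeff n) * u ^ n * legendre_factor n w"
proof -
  have "u ^ (n - k) * w ^ k = u ^ n * w ^ (2 * k)" if "k \<le> n" for k
  proof -
    have "u ^ n * w ^ (2 * k) = u ^ (n - k) * w ^ k * (u * w) ^ k"
      using that by (simp add: power_mult_distrib mult_2 power_add flip: power_add[of u "n - k" k])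
    then show ?thesis using assms by simp
  qed
  then show ?thesis
    unfolding legendre_joukowski[OF assms] legendre_factor_def sum_distrib_left
    by (intro sum.cong refl) (simp add: mult_ac)
qed

lemma half_coeff_le_1: "half_coeff k \<le> 1"
proof (induction k)
  case (Suc k)
  then show ?case unfolding half_coeff.simps by (intro mult_le_one) auto
qed simp

lemma half_coeff_series_summable:
  assumes "norm (w :: complex) < 1"
  shows "summable (\<lambda>k. norm (complex_of_real (half_coeff k) * w ^ (2 * k)))"
proof (rule summable_comparison_test')
  have "norm w ^ 2 < 1" using assms by (simp add: abs_square_less_1)
  then show "summable (\<lambda>k. (norm w ^ 2) ^ k)" by (simp add: summable_geometric)
  show "norm (norm (complex_of_real (half_coeff k) * w ^ (2 * k))) \<le> (norm w ^ 2) ^ k" if "k \<ge> 0" for k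
    using half_coeff_le_1[of k]
    by (simp add: norm_mult norm_power power_mult mult_left_le_one_le)
qed

text \<open>
  The limit is \<open>(1 - w\<^sup>2)\<^sup>-\<^sup>1\<^sup>/\<^sup>2\<close>. Squaring makes the statement independent of a branch of the root;
  the Cauchy product of the series with itself has all coefficients equal to \<open>1\<close>.
\<close>
lemma legendre_factor_lim_square:
  assumes "norm w < 1"
  shows "legendre_factor_lim w ^ 2 * (1 - w\<^sup>2) = 1"
proof -
  note s = half_coeff_series_summable[OF assms]
  have "legendre_factor_lim w ^ 2 =
      (\<Sum>k. \<Sum>i\<le>k. of_real (half_coeff i) * w ^ (2 * i) * (of_real (half_coeff (k - i)) * w ^ (2 * (k
          - i))))"
    unfolding legendre_factor_lim_def power2_eq_square by (rule Cauchy_product[OF s s])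
  also have "\<dots> = (\<Sum>k. (w\<^sup>2) ^ k)"
  proof (rule suminf_cong)
    fix k
    have "(\<Sum>i\<le>k. of_real (half_coeff i) * w ^ (2 * i) * (of_real (half_coeff (k - i)) * w ^ (2 * (k
        - i)))) =
       (\<Sum>i\<le>k. of_real (half_coeff i * half_coeff (k - i)) * (w\<^sup>2) ^ k)"
    proof (rule sum.cong)
      fix i assume "i \<in> {..k}"
      then have "(w\<^sup>2) ^ k = w ^ (2 * i) * w ^ (2 * (k - i))"
        by (simp add: diff_mult_distrib2 flip: power_mult power_add)
      then show "of_real (half_coeff i) * w ^ (2 * i) * (of_real (half_coeff (k - i)) * w ^ (2 * (k
          - i))) = of_real (half_coeff i * half_coeff (k - i)) * (w\<^sup>2) ^ k"
        by simp
    qed simp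
    also have "\<dots> = of_real (\<Sum>i\<le>k. half_coeff i * half_coeff (k - i)) * (w\<^sup>2) ^ k"
      by (simp add: sum_distrib_right)
    finally show "(\<Sum>i\<le>k. of_real (half_coeff i) * w ^ (2 * i) * (of_real (half_coeff (k - i)) * w ^
        (2 * (k - i)))) = (w\<^sup>2) ^ k"
      by (simp only: half_coeff_convolution of_real_1 mult_1)
  qed
  also have "\<dots> = 1 / (1 - w\<^sup>2)"
    using assms by (intro suminf_geometric) (simp add: norm_power abs_square_less_1)
  finally have "legendre_factor_lim w ^ 2 = 1 / (1 - w\<^sup>2)" .
  moreover have "1 - w\<^sup>2 \<noteq> 0"
  proof
    assume "1 - w\<^sup>2 = 0"
    then have "norm w ^ 2 = 1" by (simp flip: norm_power)
    moreover have "norm w ^ 2 < 1" using assms by (simp add: abs_square_less_1)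
    ultimately show False by simp
  qed
  ultimately show ?thesis by simp
qed

text \<open>
  On the disc of radius \<open>r\<close> the distance to the limit is at most
  \<open>\<Sum>\<^sub>k |d\<^sub>n\<^sub>k - c\<^sub>k| r\<^sup>2\<^sup>k\<close>, where \<open>d\<^sub>n\<^sub>k\<close> are the coefficients of the \<open>n\<close>-th factor. This bound is
  independent of \<open>w\<close>, and tends to \<open>0\<close> by Tannery's theorem, since each \<open>d\<^sub>n\<^sub>k - c\<^sub>k\<close> tends to \<open>0\<close> and lies
  in \<open>[-1, 1]\<close>.
\<close>
lemma legendre_factor_uniform_limit:
  assumes "0 \<le> r" "r < 1"
  shows "uniform_limit {w. norm w \<le> r} legendre_factor legendre_factor_lim sequentially"
proof -
  define d where "d n k = (if k \<le> n then half_coeff k * half_coeff (n - k) / half_coeff n else 0)"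
      for n k
  have d_nonneg: "0 \<le> d n k" for n k by (simp add: d_def)
  have d_le: "d n k \<le> 1" for n k
    using half_coeff_mult_le[of k "n - k"] by (cases "k \<le> n") (simp_all add: d_def)
  have d_lim: "(\<lambda>n. d n k) \<longlonglongrightarrow> half_coeff k" for k
  proof (rule LIMSEQ_offset[where k = k])
    have "(\<lambda>n. half_coeff k * (half_coeff n / half_coeff (n + k))) \<longlonglongrightarrow> half_coeff k * 1"
      by (intro tendsto_mult tendsto_const half_coeff_ratio)
    then show "(\<lambda>n. d (n + k) k) \<longlonglongrightarrow> half_coeff k" by (simp add: d_def)
  qed
  have r2: "r\<^sup>2 < 1" using assms by (simp add: abs_square_less_1)
  define e where "e n = (\<Sum>k. \<bar>d n k - half_coeff k\<bar> * (r\<^sup>2) ^ k)" for n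
  have diff_le: "\<bar>d n k - half_coeff k\<bar> \<le> 1" for n k
    using d_nonneg[of n k] d_le[of n k] half_coeff_nonneg[of k] half_coeff_le_1[of k] by linarith
  have e_summable: "summable (\<lambda>k. \<bar>d n k - half_coeff k\<bar> * (r\<^sup>2) ^ k)" for n
  proof (rule summable_comparison_test')
    show "summable (\<lambda>k. (r\<^sup>2) ^ k)" using r2 by (simp add: summable_geometric)
    show "norm (\<bar>d n k - half_coeff k\<bar> * (r\<^sup>2) ^ k) \<le> (r\<^sup>2) ^ k" if "k \<ge> 0" for k
      using diff_le[of n k] by (simp add: abs_mult mult_left_le_one_le)
  qed
  have "e \<longlonglongrightarrow> (\<Sum>k::nat. 0)"
    unfolding e_def
  proof (rule tannerys_theorem[THEN conjunct2, THEN conjunct2])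
    show "(\<lambda>n. \<bar>d n k - half_coeff k\<bar> * (r\<^sup>2) ^ k) \<longlonglongrightarrow> 0" for k
    proof -
      have "(\<lambda>n. \<bar>d n k - half_coeff k\<bar> * (r\<^sup>2) ^ k) \<longlonglongrightarrow> \<bar>half_coeff k - half_coeff k\<bar> * (r\<^sup>2) ^ k"
        by (intro tendsto_intros d_lim)
      then show ?thesis by simp
    qed
    show "\<forall>\<^sub>F (k, n) in sequentially \<times>\<^sub>F sequentially. norm (\<bar>d n k - half_coeff k\<bar> * (r\<^sup>2) ^ k) \<le>
        (r\<^sup>2) ^ k"
      using diff_le by (intro always_eventually) (auto simp: abs_mult mult_left_le_one_le)
    show "summable (\<lambda>k. (r\<^sup>2) ^ k)" using r2 by (simp add: summable_geometric)
  qed simp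
  then have e_lim: "e \<longlonglongrightarrow> 0" by simp
  have bound: "dist (legendre_factor n w) (legendre_factor_lim w) \<le> e n" if w: "norm w \<le> r" for n w
  proof -
    have 1: "legendre_factor n w = (\<Sum>k. of_real (d n k) * w ^ (2 * k))"
      by (subst suminf_finite[of "{..n}"]) (auto simp: legendre_factor_def d_def)
    have 2: "summable (\<lambda>k. of_real (d n k) * w ^ (2 * k))"
      by (rule summable_finite[of "{..n}"]) (auto simp: d_def)
    have 3: "summable (\<lambda>k. complex_of_real (half_coeff k) * w ^ (2 * k))"
      by (rule summable_norm_cancel, rule half_coeff_series_summable) (use w assms in linarith)
    have le: "norm ((of_real (d n k) - complex_of_real (half_coeff k)) * w ^ (2 * k)) \<le>
        \<bar>d n k - half_coeff k\<bar> * (r\<^sup>2) ^ k" for k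
    proof -
      have "norm ((of_real (d n k) - complex_of_real (half_coeff k)) * w ^ (2 * k)) =
          \<bar>d n k - half_coeff k\<bar> * norm w ^ (2 * k)"
        by (metis norm_mult norm_of_real norm_power of_real_diff)
      also have "\<dots> \<le> \<bar>d n k - half_coeff k\<bar> * r ^ (2 * k)"
        using w by (intro mult_left_mono power_mono) auto
      finally show ?thesis by (simp add: power_mult)
    qed
    have "legendre_factor n w - legendre_factor_lim w =
       (\<Sum>k. (of_real (d n k) - complex_of_real (half_coeff k)) * w ^ (2 * k))"
      unfolding 1 legendre_factor_lim_def suminf_diff[OF 2 3] by (simp add: left_diff_distrib)
    also have "norm \<dots> \<le> e n" unfolding e_def
      by (rule norm_suminf_le[OF le e_summable])
    finally show ?thesis by (simp add: dist_norm)
  qed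
  show ?thesis
  proof (rule uniform_limitI)
    fix \<epsilon> :: real assume "\<epsilon> > 0"
    with e_lim have "\<forall>\<^sub>F n in sequentially. e n < \<epsilon>" by (rule order_tendstoD)
    then show "\<forall>\<^sub>F n in sequentially. \<forall>w\<in>{w. norm w \<le>
        r}. dist (legendre_factor n w) (legendre_factor_lim w) < \<epsilon>"
      by eventually_elim (use bound in \<open>fastforce intro: le_less_trans\<close>)
  qed
qed

text \<open>
  The partial products of Wallis' product are the reciprocals of \<open>(2n+1) c\<^sub>n\<^sup>2\<close>.
\<close>
lemma half_coeff_wallis: "(\<lambda>n. (2 * real n + 1) * half_coeff n ^ 2) \<longlonglongrightarrow> 2 / pi"
proof -
  have "(\<Prod>k=1..n. (4 * real k ^ 2) / (4 * real k ^ 2 - 1)) =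
      inverse ((2 * real n + 1) * half_coeff n ^ 2)" for n
  proof (induction n)
    case (Suc n)
    have "4 * (real n + 1)\<^sup>2 - 1 = (2 * real n + 1) * (2 * real n + 3)"
      by (simp add: power2_eq_square algebra_simps)
    then have "4 * real (Suc n) ^ 2 / (4 * real (Suc n) ^ 2 - 1) =
        (2 * real n + 2)\<^sup>2 / ((2 * real n + 1) * (2 * real n + 3))"
      by (simp add: power2_eq_square algebra_simps)
    then have "(\<Prod>k=1..Suc n. (4 * real k ^ 2) / (4 * real k ^ 2 - 1)) =
       inverse ((2 * real n + 1) * half_coeff n ^ 2) * ((2 * real n + 2)\<^sup>2 / ((2 * real n + 1) * (2
           * real n + 3)))"
      using Suc by simp
    also have "\<dots> = inverse ((2 * real (Suc n) + 1) * half_coeff (Suc n) ^ 2)"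
      by (simp add: power_mult_distrib power_divide divide_simps) (simp add:
          algebra_simps power2_eq_square)
    finally show ?case .
  qed simp
  then have "(\<lambda>n. inverse ((2 * real n + 1) * half_coeff n ^ 2)) \<longlonglongrightarrow> pi / 2"
    using wallis by simp
  from tendsto_inverse[OF this] show ?thesis by simp
qed

section \<open>The square root on the complement of the segment\<close>

abbreviation (input) slit :: "complex set" where
  "slit \<equiv> closed_segment (-1) 1"

lemma slit_of_real: "t \<in> {-1..1} \<Longrightarrow> complex_of_real t \<in> slit"
  using of_real_closed_segment[of t "-1" 1, where 'a = complex]
  by (simp add: closed_segment_eq_real_ivl)

lemma not_slit_nonzero: "z \<notin> slit \<Longrightarrow> t \<in> {-1..1} \<Longrightarrow> z - complex_of_real t \<noteq> 0"
  using slit_of_real[of t] by auto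

lemma open_not_slit: "open (- slit)"
  by (simp add: open_Compl)

text \<open>
  The inverse of the Joukowski map \<open>u \<mapsto> (u + 1/u) / 2\<close> with values outside the closed unit disc.
\<close>
definition joukowski_inv :: "complex \<Rightarrow> complex" where
  "joukowski_inv z = z + sqrt_branch z"

context
  fixes z :: complex
  assumes z: "z \<notin> slit"
begin

lemma sqrt_branch_square: "(sqrt_branch z)\<^sup>2 = z\<^sup>2 - 1"
  and norm_joukowski_inv: "1 < norm (joukowski_inv z)"
  using theI'[OF sqrt_branch_ex1[OF z]] unfolding sqrt_branch_def joukowski_inv_def by blast+

lemma joukowski_inv_nonzero: "joukowski_inv z \<noteq> 0"
  using norm_joukowski_inv by auto

lemma inverse_joukowski_inv: "1 / joukowski_inv z = z - sqrt_branch z"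
proof -
  have "joukowski_inv z * (z - sqrt_branch z) = 1"
    using sqrt_branch_square by (simp add: joukowski_inv_def algebra_simps power2_eq_square)
  then show ?thesis using joukowski_inv_nonzero by (simp add: field_simps)
qed

lemma joukowski_inv_right: "(joukowski_inv z + 1 / joukowski_inv z) / 2 = z"
  unfolding inverse_joukowski_inv by (simp add: joukowski_inv_def)

lemma sqrt_branch_nonzero: "sqrt_branch z \<noteq> 0"
proof
  assume "sqrt_branch z = 0"
  then have "z\<^sup>2 = 1" using sqrt_branch_square by simp
  then have "z = 1 \<or> z = -1" by (simp add: power2_eq_1_iff)
  then show False using z by auto
qed

text \<open>
  The principal root has nonnegative real part, so \<open>c = \<surd>(1 - 1/z\<^sup>2)\<close> satisfies
  \<open>|1 - c| \<le> |1 + c|\<close>. The opposite sign would make \<open>1/u = z + z c\<close> the smaller of the numbers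
  \<open>z + z c\<close> and \<open>z - z c\<close>, against this inequality. The formula shows that the pointwise choice of the
  root is holomorphic, because \<open>1 - 1/z\<^sup>2\<close> avoids the cut off the segment.
\<close>
lemma sqrt_branch_eq_csqrt: "sqrt_branch z = z * csqrt (1 - 1 / z\<^sup>2)"
proof -
  define c where "c = csqrt (1 - 1 / z\<^sup>2)"
  have "z \<noteq> 0" using not_slit_nonzero[OF z, of 0] by simp
  then have sq: "(z * c)\<^sup>2 = z\<^sup>2 - 1" by (simp add: c_def power_mult_distrib field_simps)
  have "0 \<le> Re c" unfolding c_def using csqrt_principal[of "1 - 1 / z\<^sup>2"] by auto
  then have "norm (1 - c) \<le> norm (1 + c)" unfolding cmod_def by (simp add:
      power2_eq_square algebra_simps)
  then have "norm z * norm (1 - c) \<le> norm z * norm (1 + c)" by (rule mult_left_mono) simp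
  then have le: "norm (z - z * c) \<le> norm (z + z * c)" by (simp add: ring_distribs flip: norm_mult)
  have "sqrt_branch z = z * c \<or> sqrt_branch z = - (z * c)"
    using sqrt_branch_square sq power2_eq_iff by metis
  moreover have False if neg: "sqrt_branch z = - (z * c)"
  proof -
    have "norm (1 / joukowski_inv z) < 1"
      using norm_joukowski_inv by (simp add: norm_divide divide_less_eq)
    then have "norm (z + z * c) < 1" unfolding inverse_joukowski_inv neg by simp
    moreover have "1 < norm (z - z * c)" using norm_joukowski_inv by (simp add: joukowski_inv_def neg)
    ultimately show False using le by simp
  qed
  ultimately show ?thesis unfolding c_def by blast
qed

end

lemma sqrt_branch_holomorphic: "sqrt_branch holomorphic_on - slit"
proof -
  have "1 - 1 / z\<^sup>2 \<notin> \<real>\<^sub>\<le>\<^sub>0" if z: "z \<notin> slit" for z :: complex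
  proof
    assume "1 - 1 / z\<^sup>2 \<in> \<real>\<^sub>\<le>\<^sub>0"
    then obtain x where x: "1 - 1 / z\<^sup>2 = of_real x" "x \<le> 0" by (auto elim: nonpos_Reals_cases)
    have "z \<noteq> 0" using not_slit_nonzero[OF z, of 0] by simp
    then have "z\<^sup>2 * (1 - of_real x) = 1" using x(1) by (simp add: field_simps)
    moreover have "1 - complex_of_real x \<noteq> 0" using x(2) by (auto simp: complex_eq_iff)
    ultimately have "z\<^sup>2 = complex_of_real (1 / (1 - x))" by (simp add: field_simps)
    also have "\<dots> = (complex_of_real (sqrt (1 / (1 - x))))\<^sup>2"
      using x(2) by (simp flip: of_real_power)
    finally have "z = of_real (sqrt (1 / (1 - x))) \<or> z = of_real (- sqrt (1 / (1 - x)))"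
      by (simp add: power2_eq_iff)
    moreover have "\<bar>sqrt (1 / (1 - x))\<bar> \<le> 1" using x(2) by (simp add: divide_simps)
    ultimately show False using z slit_of_real by (metis abs_le_iff abs_minus_cancel
        atLeastAtMost_iff minus_le_iff)
  qed
  then have "(\<lambda>z. z * csqrt (1 - 1 / z\<^sup>2)) holomorphic_on - slit"
    by (intro holomorphic_intros) (use not_slit_nonzero[of _ 0] in auto)
  moreover have "sqrt_branch holomorphic_on - slit \<longleftrightarrow> (\<lambda>z. z * csqrt (1 - 1 / z\<^sup>2)) holomorphic_on -
      slit"
    by (rule holomorphic_cong) (simp_all add: sqrt_branch_eq_csqrt)
  ultimately show ?thesis by simp
qed

lemma joukowski_inv_holomorphic: "joukowski_inv holomorphic_on - slit"
  unfolding joukowski_inv_def[abs_def] by (intro holomorphic_intros sqrt_branch_holomorphic)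

text \<open>
  From \<open>s\<^sup>2 = z\<^sup>2 - 1\<close> one has \<open>s' = z / s\<close>, hence \<open>u' = 1 + z / s = u / s\<close>. So \<open>u\<^sup>-\<^sup>N\<close> has
  logarithmic derivative \<open>- N / s\<close>, the source of the powers in the asymptotic formula.
\<close>
lemma joukowski_inv_deriv:
  assumes z: "z \<notin> slit"
  shows "(joukowski_inv has_field_derivative joukowski_inv z / sqrt_branch z) (at z)"
proof -
  obtain d where d: "(sqrt_branch has_field_derivative d) (at z)"
    using sqrt_branch_holomorphic z open_not_slit by (metis Compl_iff field_differentiable_def
        holomorphic_on_imp_differentiable_at)
  have "((\<lambda>z. (sqrt_branch z)\<^sup>2) has_field_derivative 2 * sqrt_branch z * d) (at z)"
    using DERIV_power[OF d, of 2] by (simp add: mult_ac)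
  moreover have "((\<lambda>z. (sqrt_branch z)\<^sup>2) has_field_derivative 2 * z) (at z)"
  proof (rule has_field_derivative_transform_within_open[OF _ open_not_slit])
    show "((\<lambda>z. z\<^sup>2 - 1) has_field_derivative 2 * z) (at z)"
      by (auto intro!: derivative_eq_intros)
  qed (use z sqrt_branch_square in auto)
  ultimately have "2 * sqrt_branch z * d = 2 * z" by (rule DERIV_unique)
  then have "1 + d = joukowski_inv z / sqrt_branch z"
    using sqrt_branch_nonzero[OF z] by (simp add: joukowski_inv_def field_simps)
  moreover have "(joukowski_inv has_field_derivative 1 + d) (at z)"
    unfolding joukowski_inv_def[abs_def] by (intro derivative_intros d)
  ultimately show ?thesis by simp
qed

section \<open>The remainder function as a telescoping sum\<close>

lemma cpoly_legendre_roots: "{z. cpoly (legendre n) z = 0} = of_real ` {x. poly (legendre n) x = 0}"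
proof (rule card_seteq[symmetric])
  have nz: "map_poly complex_of_real (legendre n) \<noteq> 0" by (simp add: map_poly_eq_0_iff)
  show "finite {z. cpoly (legendre n) z = 0}" by (rule poly_roots_finite[OF nz])
  show "of_real ` {x. poly (legendre n) x = 0} \<subseteq> {z. cpoly (legendre n) z = 0}"
    by (auto simp: cpoly_of_real)
  have "card (complex_of_real ` {x. poly (legendre n) x = 0}) = n"
    by (subst card_image) (auto simp: inj_on_def card_legendre_roots)
  then show "card {z. cpoly (legendre n) z = 0} \<le> card (complex_of_real ` {x. poly (legendre n) x = 0})"
    using card_poly_roots_bound[OF nz] by (simp add: degree_map_poly)
qed

lemma cpoly_legendre_nonzero:
  assumes "z \<notin> slit"
  shows "cpoly (legendre n) z \<noteq> 0"
proof
  assume "cpoly (legendre n) z = 0"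
  then obtain x where "poly (legendre n) x = 0" "z = of_real x"
    using cpoly_legendre_roots[of n] by blast
  then show False using assms slit_of_real[of x] legendre_roots_interior[of n x] by (auto simp:
      abs_less_iff)
qed

text \<open>
  Twice the Legendre function of the second kind \<open>Q\<^sub>n(z)\<close>.
\<close>
definition legendre_cauchy :: "nat \<Rightarrow> complex \<Rightarrow> complex" where
  "legendre_cauchy n z = integral {-1..1} (\<lambda>t. complex_of_real (poly (legendre n) t) / (z -
      complex_of_real t))"

lemma gl_rem_fun_eq: "gl_rem_fun n z = legendre_cauchy n z / cpoly (legendre n) z"
  by (simp add: gl_rem_fun_def legendre_cauchy_def)

lemma cauchy_transform_integrable:
  assumes "z \<notin> slit"
  shows "(\<lambda>t. complex_of_real (poly p t) / (z - complex_of_real t)) integrable_on {-1..1}"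
  by (intro integrable_continuous_real continuous_intros) (use not_slit_nonzero[OF assms] in auto)

lemma integral_legendre_Suc: "integral {-1..1} (poly (legendre (Suc n))) = 0"
  using legendre_orthogonal[of "Suc n" "1"] by simp

lemma cauchy_transform_mult_X:
  assumes "z \<notin> slit"
  shows "integral {-1..1} (\<lambda>t. of_real (t * poly p t) / (z - of_real t)) =
     z * integral {-1..1} (\<lambda>t. of_real (poly p t) / (z - of_real t)) - of_real (integral {-1..1}
         (poly p))"
proof -
  have "integral {-1..1} (\<lambda>t. of_real (t * poly p t) / (z - of_real t)) =
     integral {-1..1} (\<lambda>t. z * (of_real (poly p t) / (z - of_real t)) - of_real (poly p t))"
    using not_slit_nonzero[OF assms] by (intro integral_cong) (simp add: field_simps)
  also have "\<dots> = integral {-1..1} (\<lambda>t. z * (of_real (poly p t) / (z - of_real t))) - integral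
      {-1..1} (\<lambda>t. of_real (poly p t))"
    by (intro integral_diff integrable_on_mult_right cauchy_transform_integrable assms
        integrable_continuous_real continuous_intros)
  also have "integral {-1..1} (\<lambda>t. complex_of_real (poly p t)) = of_real (integral {-1..1} (poly p))"
    using integral_linear[OF poly_integrable bounded_linear_of_real, of "-1" 1 p] by (simp add: o_def)
  finally show ?thesis by (simp only: integral_mult_right)
qed

text \<open>
  Multiplying the integrand by \<open>t\<close> instead of \<open>z\<close> changes the integral by \<open>\<integral> P\<^sub>n\<^sub>+\<^sub>1\<close>, which vanishes
  by orthogonality. Thus the recurrence of the Legendre polynomials passes to their Cauchy
  transforms.
\<close>
lemma legendre_cauchy_recurrence:
  assumes z: "z \<notin> slit"
  shows "(of_nat n + 2) * legendre_cauchy (Suc (Suc n)) z =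
     (2 * of_nat n + 3) * z * legendre_cauchy (Suc n) z - (of_nat n + 1) * legendre_cauchy n z"
proof -
  let ?I = "\<lambda>f. integral {-1..1} (\<lambda>t. of_real (f t) / (z - of_real t))"
  have "(of_nat n + 2) * legendre_cauchy (Suc (Suc n)) z =
      integral {-1..1} (\<lambda>t. (of_nat n + 2) * (of_real (poly (legendre (Suc (Suc n))) t) / (z -
          of_real t)))"
    unfolding legendre_cauchy_def by (rule integral_mult_right[symmetric])
  also have "\<dots> = integral {-1..1} (\<lambda>t.
      (2 * of_nat n + 3) * (of_real (t * poly (legendre (Suc n)) t) / (z - of_real t)) -
      (of_nat n + 1) * (of_real (poly (legendre n) t) / (z - of_real t)))"
  proof (rule integral_cong)
    fix t
    have "(of_nat n + 2) * complex_of_real (poly (legendre (Suc (Suc n))) t) =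
       (2 * of_nat n + 3) * of_real (t * poly (legendre (Suc n)) t) - (of_nat n + 1) * of_real (poly
           (legendre n) t)"
      using arg_cong[OF poly_legendre_recurrence[of n t], of complex_of_real] by (simp add: mult_ac)
    then show "(of_nat n + 2) * (complex_of_real (poly (legendre (Suc (Suc n))) t) / (z - of_real t)) =
       (2 * of_nat n + 3) * (of_real (t * poly (legendre (Suc n)) t) / (z - of_real t)) -
       (of_nat n + 1) * (of_real (poly (legendre n) t) / (z - of_real t))"
      by (metis (no_types, lifting) diff_divide_distrib times_divide_eq_right)
  qed
  also have "\<dots> = (2 * of_nat n + 3) * ?I (\<lambda>t. t * poly (legendre (Suc n)) t) - (of_nat n + 1) * ?I
      (poly (legendre n))"
  proof -
    have "(\<lambda>t. complex_of_real (t * poly (legendre (Suc n)) t) / (z - of_real t)) integrable_on {-1..1}"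
      using cauchy_transform_integrable[OF z, of "[:0, 1:] * legendre (Suc n)"] by simp
    then show ?thesis
      by (subst integral_diff)
         (simp_all only: integrable_on_mult_right cauchy_transform_integrable[OF z] integral_mult_right)
  qed
  finally show ?thesis
    by (simp only: cauchy_transform_mult_X[OF z] integral_legendre_Suc)
       (simp add: legendre_cauchy_def)
qed

text \<open>
  The discrete analogue of the Wronskian: for two solutions of the same three-term recurrence
  this expression is independent of \<open>n\<close>, and for \<open>n = 0\<close> it is \<open>\<integral> (z - t) / (z - t) dt\<close> over the
  segment.
\<close>
lemma legendre_casoratian:
  assumes z: "z \<notin> slit"
  shows "(of_nat n + 1) * (cpoly (legendre (Suc n)) z * legendre_cauchy n z -
            cpoly (legendre n) z * legendre_cauchy (Suc n) z) = 2"
proof (induction n)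
  case 0
  have "legendre_cauchy (Suc 0) z = z * legendre_cauchy 0 z - 2"
  proof -
    have "poly 1 = (\<lambda>_. 1 :: real)" by auto
    then have "integral {-1..1} (poly 1) = (2 :: real)" by simp
    then show ?thesis
      using cauchy_transform_mult_X[OF z, of 1] by (simp add: legendre_cauchy_def)
  qed
  then show ?case by (simp add: map_poly_pCons)
next
  case (Suc n)
  have "(of_nat (Suc n) + 1) * (cpoly (legendre (Suc (Suc n))) z * legendre_cauchy (Suc n) z -
            cpoly (legendre (Suc n)) z * legendre_cauchy (Suc (Suc n)) z) =
        ((of_nat n + 2) * cpoly (legendre (Suc (Suc n))) z) * legendre_cauchy (Suc n) z -
        cpoly (legendre (Suc n)) z * ((of_nat n + 2) * legendre_cauchy (Suc (Suc n)) z)"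
    by (simp add: algebra_simps)
  also have "\<dots> = (of_nat n + 1) * (cpoly (legendre (Suc n)) z * legendre_cauchy n z -
            cpoly (legendre n) z * legendre_cauchy (Suc n) z)"
    unfolding cpoly_legendre_recurrence legendre_cauchy_recurrence[OF z] by (simp add: algebra_simps)
  finally show ?case using Suc by simp
qed

lemma gl_rem_fun_diff:
  assumes z: "z \<notin> slit"
  shows "gl_rem_fun n z - gl_rem_fun (Suc n) z =
     2 / ((of_nat n + 1) * cpoly (legendre n) z * cpoly (legendre (Suc n)) z)"
proof -
  have n1: "of_nat n + 1 \<noteq> (0 :: complex)" by (metis of_nat_Suc of_nat_neq_0 add.commute)
  note nz = cpoly_legendre_nonzero[OF z]
  have "gl_rem_fun n z - gl_rem_fun (Suc n) z =
      (cpoly (legendre (Suc n)) z * legendre_cauchy n z - cpoly (legendre n) z * legendre_cauchy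
          (Suc n) z) /
      (cpoly (legendre n) z * cpoly (legendre (Suc n)) z)"
    unfolding gl_rem_fun_eq using nz[of n] nz[of "Suc n"] by (simp add: field_simps)
  also have "\<dots> = ((of_nat n + 1) * (cpoly (legendre (Suc n)) z * legendre_cauchy n z -
      cpoly (legendre n) z * legendre_cauchy (Suc n) z)) /
      ((of_nat n + 1) * (cpoly (legendre n) z * cpoly (legendre (Suc n)) z))"
    using n1 by simp
  finally show ?thesis unfolding legendre_casoratian[OF z] by (simp add: mult.assoc)
qed

section \<open>Leading asymptotics of the remainder function\<close>

text \<open>
  The difference \<open>k\<^sub>n - k\<^sub>n\<^sub>+\<^sub>1\<close>, multiplied by \<open>u\<^sup>2\<^sup>n\<^sup>+\<^sup>1\<close> and written as a function of \<open>w = 1/u\<close>.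
\<close>
definition rem_increment :: "nat \<Rightarrow> complex \<Rightarrow> complex" where
  "rem_increment n w = of_real (4 / ((2 * real n + 1) * half_coeff n ^ 2)) /
      (legendre_factor n w * legendre_factor (Suc n) w)"

text \<open>
  The scaled function \<open>h\<^sub>n = k\<^sub>n u\<^sup>2\<^sup>n\<^sup>+\<^sup>1\<close> satisfies \<open>h\<^sub>n = w\<^sup>2 h\<^sub>n\<^sub>+\<^sub>1 + r\<^sub>n\<close>. As \<open>r\<^sub>n\<close> will tend to
  \<open>2 \<pi> (1 - w\<^sup>2)\<close>, the expected limit of \<open>h\<^sub>n\<close> is the fixed point \<open>2 \<pi>\<close>.
\<close>
lemma scaled_gl_rem_fun_step:
  fixes n z
  assumes z: "z \<notin> slit"
  defines "u \<equiv> joukowski_inv z"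
  shows "gl_rem_fun n z * u ^ (2 * n + 1) =
     (1 / u)\<^sup>2 * (gl_rem_fun (Suc n) z * u ^ (2 * Suc n + 1)) + rem_increment n (1 / u)"
proof -
  define w where "w = 1 / u"
  have u0: "u \<noteq> 0" using joukowski_inv_nonzero[OF z] by (simp add: u_def)
  then have uw: "u * w = 1" by (simp add: w_def)
  have zu: "(u + w) / 2 = z" unfolding u_def w_def by (rule joukowski_inv_right[OF z])
  have P: "cpoly (legendre m) z = of_real (half_coeff m) * u ^ m * legendre_factor m w" for m
    using legendre_eq_factor[OF uw, of m] by (simp add: zu)
  \<comment> \<open>The quotient of consecutive coefficients turns \<open>c\<^sub>n c\<^sub>n\<^sub>+\<^sub>1\<close> into the square that Wallis controls.\<close>
  have c: "(real n + 1) * half_coeff n * half_coeff (Suc n) = (2 * real n + 1) * half_coeff n ^ 2 / 2"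
    by (simp add: power2_eq_square field_simps)
  have "(of_nat n + 1) * cpoly (legendre n) z * cpoly (legendre (Suc n)) z =
     of_real ((real n + 1) * half_coeff n * half_coeff (Suc n)) * u ^ (2 * n + 1)
     * (legendre_factor n w * legendre_factor (Suc n) w)"
    unfolding P by (simp add: mult_2 power_add del: half_coeff.simps)
  also have "\<dots> = of_real ((2 * real n + 1) * half_coeff n ^ 2 / 2) * u ^ (2 * n + 1)
     * (legendre_factor n w * legendre_factor (Suc n) w)" unfolding c ..
  finally have "2 / ((of_nat n + 1) * cpoly (legendre n) z * cpoly (legendre (Suc n)) z) * u ^ (2 *
      n + 1) =
      2 / (of_real ((2 * real n + 1) * half_coeff n ^ 2 / 2) * u ^ (2 * n + 1)
     * (legendre_factor n w * legendre_factor (Suc n) w)) * u ^ (2 * n + 1)" by (simp only:)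
  also have "\<dots> = rem_increment n w"
  proof -
    have "2 / (c / 2 * U * S) * U = 4 / c / S" if "U \<noteq> 0" for c U S :: complex
      using that by (cases "c = 0"; cases "S = 0") (simp_all add: field_simps)
    from this[of "u ^ (2 * n + 1)" "of_real ((2 * real n + 1) * half_coeff n ^ 2)"]
    show ?thesis using u0 by (simp add: rem_increment_def)
  qed
  finally have "2 / ((of_nat n + 1) * cpoly (legendre n) z * cpoly (legendre (Suc n)) z) * u ^ (2 *
      n + 1) =
      rem_increment n w" .
  then have step: "(gl_rem_fun n z - gl_rem_fun (Suc n) z) * u ^ (2 * n + 1) = rem_increment n w"
    by (simp only: gl_rem_fun_diff[OF z])
  have pow: "w\<^sup>2 * u ^ (2 * Suc n + 1) = u ^ (2 * n + 1)"
    using u0 by (simp add: w_def power2_eq_square field_simps)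
  have "gl_rem_fun n z * u ^ (2 * n + 1) =
      gl_rem_fun (Suc n) z * u ^ (2 * n + 1) + (gl_rem_fun n z - gl_rem_fun (Suc n) z) * u ^ (2 * n
          + 1)"
    by (simp only: left_diff_distrib add_diff_cancel_left' diff_add_cancel add_diff_eq)
  also have "\<dots> = w\<^sup>2 * (gl_rem_fun (Suc n) z * u ^ (2 * Suc n + 1)) + rem_increment n w"
  proof -
    have "gl_rem_fun (Suc n) z * u ^ (2 * n + 1) = w\<^sup>2 * (gl_rem_fun (Suc n) z * u ^ (2 * Suc n + 1))"
      unfolding pow[symmetric] by (simp only: mult_ac)
    then show ?thesis by (simp only: step)
  qed
  finally show ?thesis unfolding w_def .
qed

text \<open>
  The two factors in the denominator both tend to \<open>(1 - w\<^sup>2)\<^sup>-\<^sup>1\<^sup>/\<^sup>2\<close>. Its square has modulus between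
  \<open>1/2\<close> and \<open>1 / (1 - r\<^sup>2)\<close> on the disc, so products and inverses preserve uniform convergence.
\<close>
lemma rem_increment_uniform_limit:
  assumes "0 \<le> r" "r < 1"
  shows "uniform_limit {w. norm w \<le> r} rem_increment (\<lambda>w. of_real (2 * pi) * (1 - w\<^sup>2)) sequentially"
proof -
  let ?D = "{w :: complex. norm w \<le> r}"
  have r2: "r\<^sup>2 < 1" using assms by (simp add: abs_square_less_1)
  have sq: "norm (legendre_factor_lim w ^ 2) * norm (1 - w\<^sup>2) = 1" if "w \<in> ?D" for w
    using legendre_factor_lim_square[of w] that assms(2)
    by (simp flip: norm_mult)
  have up: "norm (1 - w\<^sup>2) \<le> 2" and lo: "1 - r\<^sup>2 \<le> norm (1 - w\<^sup>2)" if "w \<in> ?D" for w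
  proof -
    have w2: "norm w ^ 2 \<le> r\<^sup>2" using that by (intro power_mono) auto
    have "norm (1 - w\<^sup>2) \<le> norm (1 :: complex) + norm (w\<^sup>2)" by (rule norm_triangle_ineq4)
    then show "norm (1 - w\<^sup>2) \<le> 2" using w2 r2 by (simp add: norm_power)
    have "norm (1 :: complex) - norm (w\<^sup>2) \<le> norm (1 - w\<^sup>2)" by (rule norm_triangle_ineq2)
    then show "1 - r\<^sup>2 \<le> norm (1 - w\<^sup>2)" using w2 by (simp add: norm_power)
  qed
  have S: "uniform_limit ?D legendre_factor legendre_factor_lim sequentially"
    by (rule legendre_factor_uniform_limit[OF assms])
  have S': "uniform_limit ?D (\<lambda>n. legendre_factor (Suc n)) legendre_factor_lim sequentially"
    using S by (rule filterlim_compose[OF _ filterlim_Suc])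
  have "bounded (legendre_factor_lim ` ?D)"
  proof (rule boundedI)
    fix y assume "y \<in> legendre_factor_lim ` ?D"
    then obtain w where w: "w \<in> ?D" "y = legendre_factor_lim w" by blast
    have "norm y ^ 2 * (1 - r\<^sup>2) \<le> 1"
      using mult_left_mono[OF lo[OF w(1)], of "norm y ^ 2"] sq[OF w(1)] by (simp add: w(2) norm_power)
    then have "norm y ^ 2 \<le> 1 / (1 - r\<^sup>2)" using r2 by (simp add: field_simps)
    then show "norm y \<le> sqrt (1 / (1 - r\<^sup>2))" by (rule real_le_rsqrt)
  qed
  note mult = uniform_lim_mult[OF S S' this this]
  have "uniform_limit ?D (\<lambda>n w. inverse (legendre_factor n w * legendre_factor (Suc n) w))
      (inverse \<circ> (\<lambda>w. legendre_factor_lim w * legendre_factor_lim w)) sequentially"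
    (is "uniform_limit _ _ ?L _")
  proof (rule uniform_lim_inverse[OF mult])
    show "1 / 2 \<le> norm (legendre_factor_lim w * legendre_factor_lim w)" if "w \<in> ?D" for w
      using mult_left_mono[OF up[OF that], of "norm (legendre_factor_lim w ^ 2)"] sq[OF that]
      by (simp add: power2_eq_square)
  qed simp
  moreover have "?L w = 1 - w\<^sup>2" if "w \<in> ?D" for w
  proof -
    have "legendre_factor_lim w * legendre_factor_lim w * (1 - w\<^sup>2) = 1"
      using legendre_factor_lim_square[of w] that assms(2) by (simp add: power2_eq_square)
    then show ?thesis unfolding o_def by (rule inverse_unique)
  qed
  ultimately have inv: "uniform_limit ?D (\<lambda>n w. inverse (legendre_factor n w * legendre_factor (Suc
      n) w))
      (\<lambda>w. 1 - w\<^sup>2) sequentially"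
    by (subst (asm) uniform_limit_cong'[of _ _ _ _ "\<lambda>w. 1 - w\<^sup>2"]) auto
  have const: "uniform_limit ?D (\<lambda>n w. of_real (4 / ((2 * real n + 1) * half_coeff n ^ 2)))
      (\<lambda>_. complex_of_real (2 * pi)) sequentially"
  proof -
    have "(\<lambda>n. 4 / ((2 * real n + 1) * half_coeff n ^ 2)) \<longlonglongrightarrow> 4 / (2 / pi)"
      by (intro tendsto_divide tendsto_const half_coeff_wallis) simp
    then have "(\<lambda>n. complex_of_real (4 / ((2 * real n + 1) * half_coeff n ^ 2))) \<longlonglongrightarrow> complex_of_real
        (2 * pi)"
      using tendsto_of_real by fastforce
    then show ?thesis
      by (auto simp: uniform_limit_iff tendsto_iff elim: eventually_mono)
  qed
  have b: "bounded ((\<lambda>w. 1 - w\<^sup>2) ` ?D)" using up by (intro boundedI) auto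
  show ?thesis
    using uniform_lim_mult[OF const inv _ b] by (simp add:
        rem_increment_def[abs_def] divide_inverse image_constant_conv)
qed

lemma legendre_cauchy_bounded:
  assumes "z \<notin> slit"
  obtains B where "\<And>n. norm (legendre_cauchy n z) \<le> B"
proof -
  obtain d where d: "d > 0" "\<And>x. x \<in> slit \<Longrightarrow> d \<le> dist z x"
    using separate_point_closed[of slit z] assms by auto
  have "norm (legendre_cauchy n z) \<le> 1 / d * (1 - (-1))" for n
    unfolding legendre_cauchy_def
  proof (rule integral_bound)
    show "continuous_on {-1..1} (\<lambda>t. complex_of_real (poly (legendre n) t) / (z - complex_of_real t))"
      by (intro continuous_intros) (use not_slit_nonzero[OF assms] in auto)
    show "norm (complex_of_real (poly (legendre n) t) / (z - complex_of_real t)) \<le> 1 / d"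
      if "t \<in> {-1..1}" for t
    proof -
      have "\<bar>poly (legendre n) t\<bar> \<le> 1" using that by (intro abs_legendre_le_1) auto
      moreover have "d \<le> norm (z - complex_of_real t)" using d(2)[OF slit_of_real[OF that]] by (simp
          add: dist_norm)
      ultimately show ?thesis using d(1) by (simp add: norm_divide frac_le)
    qed
  qed simp
  then show thesis by (rule that)
qed

text \<open>
  A crude lower bound, enough for \<open>P\<^sub>n(z)\<close> to grow: \<open>w\<^sup>n / c\<^sub>n\<close> tends to \<open>0\<close> for \<open>|w| < 1\<close>.
\<close>
lemma half_coeff_lower: "1 \<le> (2 * real n + 1) * half_coeff n"
proof (induction n)
  case (Suc n)
  have "1 * 1 \<le> ((2 * real n + 3) / (2 * real n + 2)) * ((2 * real n + 1) * half_coeff n)"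
    by (rule mult_mono) (use Suc in auto)
  then show ?case by (simp add: field_simps)
qed simp

text \<open>
  The numerators are bounded because \<open>|P\<^sub>n| \<le> 1\<close> on the segment, and the denominators
  \<open>P\<^sub>n(z)\<close> tend to infinity. This excludes the solutions of the backward recursion in
  \<open>scaled_gl_rem_fun_step\<close> that grow like \<open>u\<^sup>2\<^sup>n\<close>.
\<close>
lemma gl_rem_fun_tendsto_0:
  assumes z: "z \<notin> slit"
  shows "(\<lambda>n. gl_rem_fun n z) \<longlonglongrightarrow> 0"
proof -
  define u where "u = joukowski_inv z"
  define w where "w = 1 / u"
  have u0: "u \<noteq> 0" and u1: "norm u > 1"
    using joukowski_inv_nonzero[OF z] norm_joukowski_inv[OF z] by (simp_all add: u_def)
  have uw: "u * w = 1" using u0 by (simp add: w_def)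
  have w1: "norm w < 1" using u1 by (simp add: w_def norm_divide divide_less_eq)
  have zu: "(u + w) / 2 = z" unfolding u_def w_def by (rule joukowski_inv_right[OF z])
  have P: "inverse (cpoly (legendre n) z) = of_real (1 / half_coeff n) * w ^ n * inverse
      (legendre_factor n w)" for n
    using legendre_eq_factor[OF uw, of n, unfolded zu] by (simp add: w_def power_inverse divide_inverse)
  have "legendre_factor_lim w \<noteq> 0" using legendre_factor_lim_square[OF w1] by auto
  moreover have "(\<lambda>n. legendre_factor n w) \<longlonglongrightarrow> legendre_factor_lim w"
    using legendre_factor_uniform_limit[of "norm w"] w1 by (auto intro: tendsto_uniform_limitI)
  ultimately have S: "(\<lambda>n. inverse (legendre_factor n w)) \<longlonglongrightarrow> inverse (legendre_factor_lim w)"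
    by (intro tendsto_inverse)
  have "(\<lambda>n. of_real (1 / half_coeff n) * w ^ n) \<longlonglongrightarrow> 0"
  proof (rule Lim_null_comparison)
    have "(\<lambda>n. 2 * (of_nat n * norm w ^ n) + norm w ^ n) \<longlonglongrightarrow> 2 * 0 + 0"
      using w1 by (intro tendsto_intros powser_times_n_limit_0 LIMSEQ_power_zero) auto
    then show "(\<lambda>n. 2 * (real n * norm w ^ n) + norm w ^ n) \<longlonglongrightarrow> 0" by simp
    have "1 / half_coeff n \<le> 2 * real n + 1" for n
      using half_coeff_lower[of n] half_coeff_pos[of n] by (simp add: divide_le_eq)
    then have "1 / half_coeff n * norm w ^ n \<le> (2 * real n + 1) * norm w ^ n" for n
      by (intro mult_right_mono) auto
    then show "\<forall>\<^sub>F n in sequentially. norm (of_real (1 / half_coeff n) * w ^ n) \<le>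
        2 * (real n * norm w ^ n) + norm w ^ n"
      by (intro always_eventually) (simp add: norm_mult norm_divide norm_power algebra_simps)
  qed
  from tendsto_mult[OF this S] have "(\<lambda>n. inverse (cpoly (legendre n) z)) \<longlonglongrightarrow> 0"
    unfolding P by simp
  then have inv: "(\<lambda>n. norm (inverse (cpoly (legendre n) z))) \<longlonglongrightarrow> 0"
    by (rule tendsto_norm_zero)
  obtain B where B: "\<And>n. norm (legendre_cauchy n z) \<le> B"
    using legendre_cauchy_bounded[OF z] by blast
  show ?thesis
  proof (rule Lim_null_comparison)
    show "(\<lambda>n. B * norm (inverse (cpoly (legendre n) z))) \<longlonglongrightarrow> 0"
      using tendsto_mult_left[OF inv, of B] by simp
    show "\<forall>\<^sub>F n in sequentially. norm (gl_rem_fun n z) \<le> B * norm (inverse (cpoly (legendre n) z))"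
      unfolding gl_rem_fun_eq divide_inverse norm_mult
      by (intro always_eventually allI mult_right_mono B) simp
  qed
qed

text \<open>
  Backward recursion is a contraction with factor \<open>|w|\<^sup>2\<close>. If the deviations of the increments from
  their limit are at most \<open>E (1 - |w|\<^sup>2)\<close> from \<open>n\<close> on, then iterating \<open>m\<close> times bounds the deviation
  of \<open>h\<^sub>n\<close> by \<open>E\<close> plus \<open>|w|\<^sup>2\<^sup>m\<close> times that of \<open>h\<^sub>n\<^sub>+\<^sub>m\<close>; the last term is essentially
  \<open>|u\<^sup>2\<^sup>n\<^sup>+\<^sup>1 k\<^sub>n\<^sub>+\<^sub>m|\<close> and disappears as \<open>m\<close> grows.
\<close>
lemma scaled_gl_rem_fun_bound:
  fixes n z
  assumes z: "z \<notin> slit"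
  defines "u \<equiv> joukowski_inv z"
  assumes E: "\<And>m. m \<ge> n \<Longrightarrow> norm (rem_increment m (1 / u) - of_real (2 * pi) * (1 - (1 / u)\<^sup>2)) \<le>
      E * (1 - norm (1 / u) ^ 2)"
  shows "norm (gl_rem_fun n z * u ^ (2 * n + 1) - of_real (2 * pi)) \<le> E"
proof -
  define w where "w = 1 / u"
  have u0: "u \<noteq> 0" and u1: "norm u > 1"
    using joukowski_inv_nonzero[OF z] norm_joukowski_inv[OF z] by (simp_all add: u_def)
  have w1: "norm w < 1" using u1 by (simp add: w_def norm_divide divide_less_eq)
  define d where "d m = gl_rem_fun m z * u ^ (2 * m + 1) - of_real (2 * pi)" for m
  have step: "norm (d m) \<le> norm w ^ 2 * norm (d (Suc m)) + E * (1 - norm w ^ 2)" if "m \<ge> n" for m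
  proof -
    have "d m = w\<^sup>2 * d (Suc m) + (rem_increment m w - of_real (2 * pi) * (1 - w\<^sup>2))"
      using scaled_gl_rem_fun_step[OF z, of m] unfolding d_def u_def[symmetric] w_def[symmetric]
      by (simp add: algebra_simps)
    then have "norm (d m) \<le> norm (w\<^sup>2 * d (Suc m)) + norm (rem_increment m w - of_real (2 * pi) * (1
        - w\<^sup>2))"
      by (simp only: norm_triangle_ineq)
    with E[OF that] show ?thesis unfolding w_def by (simp add: norm_mult norm_power)
  qed
  have iter: "norm (d n) \<le> (norm w ^ 2) ^ m * norm (d (n + m)) + E * (1 - (norm w ^ 2) ^ m)" for m
  proof (induction m)
    case (Suc m)
    have "(norm w ^ 2) ^ m * norm (d (n + m)) \<le>
        (norm w ^ 2) ^ m * (norm w ^ 2 * norm (d (Suc (n + m))) + E * (1 - norm w ^ 2))"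
      by (intro mult_left_mono step) auto
    with Suc show ?case by (simp add: algebra_simps)
  qed simp
  have pow0: "(\<lambda>m. (norm w ^ 2) ^ m) \<longlonglongrightarrow> 0"
    using w1 by (intro LIMSEQ_power_zero) (simp add: abs_square_less_1)
  have "(\<lambda>m. (norm w ^ 2) ^ m * norm (d (n + m))) \<longlonglongrightarrow> 0"
  proof (rule Lim_null_comparison)
    have "(\<lambda>m. norm (u ^ (2 * n + 1)) * norm (gl_rem_fun (n + m) z) + (norm w ^ 2) ^ m * (2 * pi)) \<longlonglongrightarrow>
        norm (u ^ (2 * n + 1)) * norm (0 :: complex) + 0 * (2 * pi)"
      by (intro tendsto_intros pow0 LIMSEQ_ignore_initial_segment[OF gl_rem_fun_tendsto_0[OF z], of
          n, unfolded add.commute[of _ n]])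
    then show "(\<lambda>m. norm (u ^ (2 * n + 1)) * norm (gl_rem_fun (n + m) z) + (norm w ^ 2) ^ m * (2 *
        pi)) \<longlonglongrightarrow> 0"
      by simp
    have "(norm w ^ 2) ^ m * norm (d (n + m)) \<le>
        norm (u ^ (2 * n + 1)) * norm (gl_rem_fun (n + m) z) + (norm w ^ 2) ^ m * (2 * pi)" for m
    proof -
      have "norm (d (n + m)) \<le> norm (gl_rem_fun (n + m) z * u ^ (2 * (n + m) + 1)) + 2 * pi"
        unfolding d_def by (rule order_trans[OF norm_triangle_ineq4]) simp
      then have "(norm w ^ 2) ^ m * norm (d (n + m)) \<le>
          (norm w ^ 2) ^ m * (norm (gl_rem_fun (n + m) z * u ^ (2 * (n + m) + 1)) + 2 * pi)"
        by (intro mult_left_mono) auto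
      also have "\<dots> = (norm w ^ 2) ^ m * norm (gl_rem_fun (n + m) z * u ^ (2 * (n + m) + 1)) + (norm
          w ^ 2) ^ m * (2 * pi)"
        by (rule distrib_left)
      also have "(norm w ^ 2) ^ m * norm (gl_rem_fun (n + m) z * u ^ (2 * (n + m) + 1)) =
          norm (u ^ (2 * n + 1)) * norm (gl_rem_fun (n + m) z)"
      proof -
        have "(w\<^sup>2) ^ m * u ^ (2 * (n + m) + 1) = (w * u) ^ (2 * m) * u ^ (2 * n + 1)"
        proof -
          have "(w\<^sup>2) ^ m = w ^ (2 * m)" by (simp add: power_mult)
          moreover have "u ^ (2 * (n + m) + 1) = u ^ (2 * m) * u ^ (2 * n + 1)"
            by (simp add: power_add algebra_simps)
          ultimately show ?thesis by (simp only: power_mult_distrib mult_ac)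
        qed
        also have "\<dots> = u ^ (2 * n + 1)" using u0 by (simp add: w_def)
        finally have "(w\<^sup>2) ^ m * u ^ (2 * (n + m) + 1) = u ^ (2 * n + 1)" .
        then have "norm ((w\<^sup>2) ^ m * u ^ (2 * (n + m) + 1)) = norm (u ^ (2 * n + 1))"
          by (rule arg_cong)
        then have eq: "(norm w ^ 2) ^ m * norm u ^ (2 * (n + m) + 1) = norm u ^ (2 * n + 1)"
          by (simp only: norm_mult norm_power)
        show ?thesis unfolding norm_mult norm_power eq[symmetric] by (simp only: mult_ac)
      qed
      finally show ?thesis .
    qed
    then show "\<forall>\<^sub>F m in sequentially. norm ((norm w ^ 2) ^ m * norm (d (n + m))) \<le>
        norm (u ^ (2 * n + 1)) * norm (gl_rem_fun (n + m) z) + (norm w ^ 2) ^ m * (2 * pi)"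
      by (intro always_eventually) simp
  qed
  then have "(\<lambda>m. (norm w ^ 2) ^ m * norm (d (n + m)) + E * (1 - (norm w ^ 2) ^ m)) \<longlonglongrightarrow> 0 + E * (1 - 0)"
    by (intro tendsto_intros pow0)
  then show ?thesis
    unfolding d_def[symmetric] using iter by (intro LIMSEQ_le_const[of _ E]) auto
qed

lemma scaled_gl_rem_fun_uniform_limit:
  assumes "0 \<le> r" "r < 1"
  shows "uniform_limit {z. z \<notin> slit \<and> norm (1 / joukowski_inv z) \<le> r}
     (\<lambda>n z. gl_rem_fun n z * joukowski_inv z ^ (2 * n + 1)) (\<lambda>_. of_real (2 * pi)) sequentially"
proof (rule uniform_limitI)
  fix e :: real assume e: "e > 0"
  \<comment> \<open>Half of \<open>e\<close>, because the bound obtained is not strict.\<close>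
  define E where "E = e / 2"
  have r2: "r\<^sup>2 < 1" using assms by (simp add: abs_square_less_1)
  then have E: "E * (1 - r\<^sup>2) > 0" "E > 0" using e by (auto simp: E_def)
  obtain N where N: "\<And>n w. n \<ge> N \<Longrightarrow> norm w \<le> r \<Longrightarrow>
      norm (rem_increment n w - of_real (2 * pi) * (1 - w\<^sup>2)) < E * (1 - r\<^sup>2)"
    using uniform_limitD[OF rem_increment_uniform_limit[OF assms] E(1)]
    unfolding eventually_sequentially dist_norm by blast
  show "\<forall>\<^sub>F n in sequentially. \<forall>z\<in>{z. z \<notin> slit \<and> norm (1 / joukowski_inv z) \<le> r}.
      dist (gl_rem_fun n z * joukowski_inv z ^ (2 * n + 1)) (of_real (2 * pi)) < e"
    unfolding eventually_sequentially
  proof (intro exI allI impI ballI)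
    fix n z assume n: "N \<le> n" and "z \<in> {z. z \<notin> slit \<and> norm (1 / joukowski_inv z) \<le> r}"
    then have z: "z \<notin> slit" and w: "norm (1 / joukowski_inv z) \<le> r" by auto
    have "norm (1 / joukowski_inv z) ^ 2 \<le> r\<^sup>2" using w by (intro power_mono) auto
    then have "E * (1 - r\<^sup>2) \<le> E * (1 - norm (1 / joukowski_inv z) ^ 2)"
      using E by (intro mult_left_mono) auto
    then have "norm (gl_rem_fun n z * joukowski_inv z ^ (2 * n + 1) - of_real (2 * pi)) \<le> E"
      using n by (intro scaled_gl_rem_fun_bound[OF z] order_trans[OF less_imp_le[OF N[OF _ w]]]) auto
    also have "E < e" using e by (simp add: E_def)
    finally show "dist (gl_rem_fun n z * joukowski_inv z ^ (2 * n + 1)) (of_real (2 * pi)) < e"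
      by (simp add: dist_norm)
  qed
qed

lemma scaled_gl_rem_fun_locally_uniform:
  assumes z: "z \<notin> slit"
  shows "\<exists>e>0. ball z e \<subseteq> - slit \<and> uniform_limit (ball z e)
     (\<lambda>n z. gl_rem_fun n z * joukowski_inv z ^ (2 * n + 1)) (\<lambda>_. of_real (2 * pi)) sequentially"
proof -
  \<comment> \<open>Any number strictly between \<open>1\<close> and \<open>|u(z)|\<close>; near \<open>z\<close> the modulus of \<open>u\<close> stays above it.\<close>
  define R where "R = (1 + norm (joukowski_inv z)) / 2"
  have R: "1 < R" "R < norm (joukowski_inv z)"
    using norm_joukowski_inv[OF z] by (auto simp: R_def)
  have "open (- slit \<inter> joukowski_inv -` {u. R < norm u})"
    by (rule continuous_open_preimage[OF holomorphic_on_imp_continuous_on[OF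
        joukowski_inv_holomorphic] open_not_slit])
       (intro open_Collect_less continuous_intros)
  then obtain e where e: "e > 0" "ball z e \<subseteq> - slit \<inter> joukowski_inv -` {u. R < norm u}"
    using z R(2) open_contains_ball by (metis (no_types, lifting) ComplI IntI mem_Collect_eq vimageI)
  have "uniform_limit {z. z \<notin> slit \<and> norm (1 / joukowski_inv z) \<le> 1 / R}
     (\<lambda>n z. gl_rem_fun n z * joukowski_inv z ^ (2 * n + 1)) (\<lambda>_. of_real (2 * pi)) sequentially"
    using R(1) by (intro scaled_gl_rem_fun_uniform_limit) auto
  moreover have "ball z e \<subseteq> {z. z \<notin> slit \<and> norm (1 / joukowski_inv z) \<le> 1 / R}"
  proof
    fix x assume "x \<in> ball z e"
    then have x: "x \<notin> slit" "R < norm (joukowski_inv x)" using e(2) by blast+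
    then have "1 / norm (joukowski_inv x) \<le> 1 / R" using R(1) by (intro frac_le) simp_all
    with x(1) show "x \<in> {z. z \<notin> slit \<and> norm (1 / joukowski_inv z) \<le> 1 / R}"
      by (simp add: norm_divide)
  qed
  ultimately have "uniform_limit (ball z e)
     (\<lambda>n z. gl_rem_fun n z * joukowski_inv z ^ (2 * n + 1)) (\<lambda>_. of_real (2 * pi)) sequentially"
    by (rule uniform_limit_on_subset)
  then show ?thesis using e by blast
qed

section \<open>The remainder function as a quadrature remainder\<close>

text \<open>
  At a node \<open>x\<close>, the polynomial \<open>P\<^sub>n(t) / (t - x)\<close>; divided by \<open>P\<^sub>n'(x)\<close> it is the Lagrange basis
  polynomial of \<open>x\<close>.
\<close>
definition lagrange_cofactor :: "nat \<Rightarrow> real \<Rightarrow> real poly" where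
  "lagrange_cofactor n x = legendre n div [:-x, 1:]"

context
  fixes n :: nat and x :: real
  assumes x: "poly (legendre n) x = 0"
begin

lemma legendre_eq_cofactor: "legendre n = [:-x, 1:] * lagrange_cofactor n x"
  using x by (simp add: lagrange_cofactor_def poly_eq_0_iff_dvd del: mult_pCons_left)

lemma degree_lagrange_cofactor: "Suc (degree (lagrange_cofactor n x)) = n"
proof -
  have "lagrange_cofactor n x \<noteq> 0" using legendre_eq_cofactor by (metis legendre_nonzero
      mult_zero_right)
  then have "degree ([:-x, 1:] * lagrange_cofactor n x) =
      degree [:-x, 1:] + degree (lagrange_cofactor n x)"
    by (intro degree_mult_eq) auto
  then show ?thesis by (simp only: legendre_eq_cofactor[symmetric]) simp
qed

lemma poly_lagrange_cofactor: "poly (legendre n) t = (t - x) * poly (lagrange_cofactor n x) t"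
  by (subst legendre_eq_cofactor) (simp add: algebra_simps)

lemma pderiv_legendre_root: "poly (pderiv (legendre n)) x = poly (lagrange_cofactor n x) x"
  by (subst legendre_eq_cofactor) (simp add: pderiv_mult pderiv_pCons del: mult_pCons_left)

lemma lagrange_cofactor_root:
  assumes "poly (legendre n) y = 0" "y \<noteq> x"
  shows "poly (lagrange_cofactor n x) y = 0"
  using assms poly_lagrange_cofactor[of y] by simp

text \<open>
  Otherwise the cofactor would vanish at all \<open>n\<close> zeros of \<open>P\<^sub>n\<close>, but its degree is \<open>n - 1\<close>.
\<close>
lemma pderiv_legendre_root_nonzero: "poly (pderiv (legendre n)) x \<noteq> 0"
proof
  assume "poly (pderiv (legendre n)) x = 0"
  then have "{y. poly (legendre n) y = 0} \<subseteq> {y. poly (lagrange_cofactor n x) y = 0}"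
    using lagrange_cofactor_root by (auto simp: pderiv_legendre_root)
  moreover have nz: "lagrange_cofactor n x \<noteq> 0"
    using legendre_eq_cofactor by (metis legendre_nonzero mult_zero_right)
  ultimately have "n \<le> card {y. poly (lagrange_cofactor n x) y = 0}"
    using card_mono[OF poly_roots_finite[OF nz]] card_legendre_roots[of n] by metis
  also have "\<dots> \<le> degree (lagrange_cofactor n x)" by (rule card_poly_roots_bound[OF nz])
  finally show False using degree_lagrange_cofactor by simp
qed

text \<open>
  This identifies the weights with the integrals of the Lagrange basis polynomials. With \<open>\<phi>\<close>
  the cofactor, compute \<open>\<integral> P\<^sub>n' \<phi>\<close> in two ways. First, \<open>P\<^sub>n' = P\<^sub>n'(x) + (t - x) r\<close> and
  \<open>(t - x) \<phi> = P\<^sub>n\<close> is orthogonal to \<open>r\<close>, so the integral is \<open>P\<^sub>n'(x) \<integral> \<phi>\<close>. Second, by parts and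
  orthogonality only the boundary terms \<open>1 / (1 - x) + 1 / (1 + x)\<close> remain.
\<close>
lemma integral_lagrange_cofactor:
  "integral {-1..1} (poly (lagrange_cofactor n x)) = gl_weight n x * poly (pderiv (legendre n)) x"
proof -
  define \<phi> where "\<phi> = lagrange_cofactor n x"
  define D where "D = poly (pderiv (legendre n)) x"
  have D0: "D \<noteq> 0" unfolding D_def by (rule pderiv_legendre_root_nonzero)
  have x1: "\<bar>x\<bar> < 1" by (rule legendre_roots_interior[OF x])
  have n0: "n > 0" using degree_lagrange_cofactor by simp
  have "poly (pderiv (legendre n) - [:D:]) x = 0" by (simp add: D_def)
  then obtain r where r: "pderiv (legendre n) - [:D:] = [:-x, 1:] * r"
    unfolding poly_eq_0_iff_dvd by (elim dvdE)
  have deg_r: "degree r < n"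
  proof (cases "r = 0")
    case False
    then have "Suc (degree r) = degree ([:-x, 1:] * r)" by (subst degree_mult_eq) auto
    also have "\<dots> \<le> n - 1" unfolding r[symmetric]
      by (rule degree_diff_le) (auto simp: degree_pderiv)
    finally show ?thesis using n0 by simp
  qed (use n0 in simp)
  have split: "poly (pderiv (legendre n)) t * poly \<phi> t =
      D * poly \<phi> t + poly (legendre n) t * poly r t" for t
  proof -
    have "poly (pderiv (legendre n)) t = D + (t - x) * poly r t"
      using arg_cong[OF r, of "\<lambda>p. poly p t"] by (simp add: algebra_simps)
    then show ?thesis
      unfolding poly_lagrange_cofactor[of t] \<phi>_def[symmetric] by (simp only: ring_distribs mult_ac)
  qed
  have "integral {-1..1} (\<lambda>t. poly (pderiv (legendre n)) t * poly \<phi> t) =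
      integral {-1..1} (\<lambda>t. D * poly \<phi> t) + integral {-1..1} (\<lambda>t. poly (legendre n) t * poly r t)"
    unfolding split by (intro integral_add integrable_continuous_real continuous_intros)
  also have "integral {-1..1} (\<lambda>t. poly (legendre n) t * poly r t) = 0"
    using deg_r by (intro legendre_orthogonal coeff_eq_0) simp
  finally have 1: "integral {-1..1} (\<lambda>t. poly (pderiv (legendre n)) t * poly \<phi> t) =
      D * integral {-1..1} (poly \<phi>)"
    by simp
  have orth: "integral {-1..1} (\<lambda>t. poly (legendre n) t * poly (pderiv \<phi>) t) = 0"
    using degree_lagrange_cofactor
    by (intro legendre_orthogonal coeff_eq_0) (simp add: degree_pderiv \<phi>_def)
  have "poly \<phi> 1 = 1 / (1 - x)" "poly \<phi> (-1) = - ((-1) ^ n / (1 + x))"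
    using poly_lagrange_cofactor[of 1] poly_lagrange_cofactor[of "-1"] x1
    by (auto simp: \<phi>_def poly_legendre_minus_one field_simps)
  then have "integral {-1..1} (\<lambda>t. poly (pderiv (legendre n)) t * poly \<phi> t) = 1 / (1 - x) + 1 / (1 + x)"
    unfolding integral_pderiv_mult orth by (simp add: poly_legendre_minus_one flip: power_add)
  also have "\<dots> = 2 / (1 - x\<^sup>2)"
  proof -
    have "1 - x \<noteq> 0" "1 + x \<noteq> 0" using x1 by auto
    moreover have "1 - x\<^sup>2 = (1 - x) * (1 + x)" by (simp add: power2_eq_square algebra_simps)
    ultimately show ?thesis by (simp add: add_frac_eq)
  qed
  finally have "D * integral {-1..1} (poly \<phi>) = 2 / (1 - x\<^sup>2)" using 1 by simp
  moreover have "gl_weight n x * D = 2 / (1 - x\<^sup>2) / D"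
    unfolding gl_weight_def D_def[symmetric] using D0 by (simp add: power2_eq_square)
  moreover have "integral {-1..1} (poly \<phi>) = D * integral {-1..1} (poly \<phi>) / D" using D0 by simp
  ultimately show ?thesis
    unfolding D_def[symmetric] \<phi>_def[symmetric] by simp
qed

end

lemma lagrange_partition_of_unity:
  assumes "n > 0"
  shows "(\<Sum>x | poly (legendre n) x = 0. smult (1 / poly (pderiv (legendre n)) x) (lagrange_cofactor
      n x)) = 1"
proof (rule poly_eqI_degree)
  let ?R = "{x. poly (legendre n) x = 0}"
  show "poly (\<Sum>x\<in>?R. smult (1 / poly (pderiv (legendre n)) x) (lagrange_cofactor n x)) y = poly 1 y"
    if y: "y \<in> ?R" for y
  proof -
    have "poly (\<Sum>x\<in>?R. smult (1 / poly (pderiv (legendre n)) x) (lagrange_cofactor n x)) y =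
       (\<Sum>x\<in>?R. if x = y then 1 else 0)"
      unfolding poly_sum
      using y lagrange_cofactor_root[of n _ y] pderiv_legendre_root[of n y]
          pderiv_legendre_root_nonzero[of n y]
      by (intro sum.cong) auto
    then show ?thesis using y by (simp add: finite_legendre_roots)
  qed
  show "degree (\<Sum>x\<in>?R. smult (1 / poly (pderiv (legendre n)) x) (lagrange_cofactor n x)) < card ?R"
    unfolding card_legendre_roots
  proof (rule le_less_trans)
    show "degree (\<Sum>x\<in>?R. smult (1 / poly (pderiv (legendre n)) x) (lagrange_cofactor n x)) \<le> n - 1"
      using degree_lagrange_cofactor
      by (intro degree_sum_le finite_legendre_roots order_trans[OF degree_smult_le]) fastforce
  qed (use assms in simp)
  show "degree (1 :: real poly) < card ?R" using assms by (simp add: card_legendre_roots)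
qed

text \<open>
  The remainder functional for complex-valued integrands, so that \<open>x \<mapsto> 1 / (z - x)\<close> can be inserted.
\<close>
definition complex_gl_remainder :: "nat \<Rightarrow> (real \<Rightarrow> complex) \<Rightarrow> complex" where
  "complex_gl_remainder n f =
     integral {-1..1} f - (\<Sum>x | poly (legendre n) x = 0. f x * of_real (gl_weight n x))"

text \<open>
  The Cauchy kernel minus its Lagrange interpolant in \<open>t\<close>. The proof multiplies the interpolant by
  \<open>z - t = (z - x) - (t - x)\<close> and uses that the basis polynomials sum to \<open>1\<close>, once at \<open>t\<close> and once
  at \<open>z\<close>; the second gives the partial fraction expansion of \<open>1 / P\<^sub>n(z)\<close>.
\<close>
lemma cauchy_kernel_interpolation:
  assumes "n > 0" "z \<notin> slit" "t \<in> {-1..1}"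
  shows "of_real (poly (legendre n) t) / (z - of_real t) / cpoly (legendre n) z =
     1 / (z - of_real t) - (\<Sum>x | poly (legendre n) x = 0.
        1 / (z - of_real x) * of_real (poly (lagrange_cofactor n x) t / poly (pderiv (legendre n)) x))"
proof -
  let ?R = "{x. poly (legendre n) x = 0}"
  define D where "D x = complex_of_real (poly (pderiv (legendre n)) x)" for x
  define \<phi> where "\<phi> x y = cpoly (lagrange_cofactor n x) y" for x y
  define P where "P = cpoly (legendre n)"
  have cof: "P y = (y - of_real x) * \<phi> x y" if "x \<in> ?R" for x y
    unfolding P_def \<phi>_def using that
    by (subst legendre_eq_cofactor) (simp_all add:
        map_poly_of_real_hom map_poly_pCons algebra_simps del: mult_pCons_left)
  have unity: "(\<Sum>x\<in>?R. \<phi> x y / D x) = 1" for y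
  proof -
    have "cpoly (\<Sum>x\<in>?R. smult (1 / poly (pderiv (legendre n)) x) (lagrange_cofactor n x)) y =
        (\<Sum>x\<in>?R. \<phi> x y / D x)"
      unfolding \<phi>_def D_def using finite_legendre_roots[of n]
      by (induction rule: finite_induct) (simp_all add: map_poly_of_real_hom)
    then show ?thesis by (simp add: lagrange_partition_of_unity[OF assms(1)])
  qed
  have zx: "z - of_real x \<noteq> 0" if "x \<in> ?R" for x
    using not_slit_nonzero[OF assms(2), of x] legendre_roots_interior[of n x] that by (simp add:
        abs_less_iff)
  have zt: "z - of_real t \<noteq> 0" using not_slit_nonzero[OF assms(2,3)] .
  have Pz: "P z \<noteq> 0" unfolding P_def by (rule cpoly_legendre_nonzero[OF assms(2)])
  have "(\<Sum>x\<in>?R. 1 / (D x * (z - of_real x))) * P z = (\<Sum>x\<in>?R. \<phi> x z / D x)"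
    unfolding sum_distrib_right
  proof (intro sum.cong refl)
    fix x assume "x \<in> ?R"
    then show "1 / (D x * (z - of_real x)) * P z = \<phi> x z / D x" using zx[of x] cof[of x z] by simp
  qed
  then have inv: "(\<Sum>x\<in>?R. 1 / (D x * (z - of_real x))) = 1 / P z"
    using Pz unity[of z] by (simp add: field_simps)
  have "(z - of_real t) * (\<Sum>x\<in>?R. 1 / (z - of_real x) * (\<phi> x (of_real t) / D x)) =
     (\<Sum>x\<in>?R. \<phi> x (of_real t) / D x - P (of_real t) * (1 / (D x * (z - of_real x))))"
    unfolding sum_distrib_left
  proof (intro sum.cong refl)
    fix x assume x: "x \<in> ?R"
    define Z T where "Z = z - complex_of_real x" and "T = complex_of_real t - of_real x"
    have "z - of_real t = Z - T" by (simp add: Z_def T_def)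
    moreover have "(Z - T) * (1 / Z * (f / d)) =
        f / d - T * f * (1 / (d * Z))" if "Z \<noteq> 0" for f d :: complex
      using that by (cases "d = 0") (simp_all add: field_simps)
    ultimately show "(z - of_real t) * (1 / (z - of_real x) * (\<phi> x (of_real t) / D x)) =
        \<phi> x (of_real t) / D x - P (of_real t) * (1 / (D x * (z - of_real x)))"
      using zx[OF x] cof[OF x] by (simp add: Z_def T_def)
  qed
  also have "\<dots> = 1 - P (of_real t) / P z"
    unfolding sum_subtractf sum_distrib_left[symmetric] inv unity by simp
  finally have "(\<Sum>x\<in>?R. 1 / (z - of_real x) * (\<phi> x (of_real t) / D x)) =
      (1 - P (of_real t) / P z) / (z - of_real t)"
    using zt by (simp add: eq_divide_eq mult.commute)
  moreover have "P (of_real t) = of_real (poly (legendre n) t)"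
    unfolding P_def by (rule cpoly_of_real)
  moreover have "\<phi> x (of_real t) / D x = of_real (poly (lagrange_cofactor n x) t / poly (pderiv
      (legendre n)) x)" for x
    by (simp add: \<phi>_def D_def cpoly_of_real)
  ultimately show ?thesis
    by (simp add: P_def[symmetric] diff_divide_distrib mult.commute)
qed

lemma integrable_resolvent:
  assumes "z \<notin> slit"
  shows "(\<lambda>t. c / (z - complex_of_real t) ^ q) integrable_on {-1..1}"
  by (intro integrable_continuous_real continuous_intros) (use not_slit_nonzero[OF assms] in auto)

lemma gl_rem_fun_eq_remainder:
  assumes z: "z \<notin> slit"
  shows "gl_rem_fun n z = complex_gl_remainder n (\<lambda>t. 1 / (z - of_real t))"
proof (cases "n = 0")
  case True
  then show ?thesis by (simp add: gl_rem_fun_def complex_gl_remainder_def)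
next
  case False
  let ?R = "{x. poly (legendre n) x = 0}"
  let ?l = "\<lambda>x t. complex_of_real (poly (lagrange_cofactor n x) t / poly (pderiv (legendre n)) x)"
  have l: "integral {-1..1} (?l x) = of_real (gl_weight n x)" "?l x integrable_on {-1..1}" if "x \<in>
      ?R" for x
  proof -
    have "(poly (lagrange_cofactor n x) has_integral gl_weight n x * poly (pderiv (legendre n)) x)
        {-1..1}"
      using integral_lagrange_cofactor[of n x] that integrable_integral[OF poly_integrable[of
          "lagrange_cofactor n x" "-1" 1]] by simp
    from has_integral_divide[OF this, of "poly (pderiv (legendre n)) x"]
    have "((\<lambda>t. poly (lagrange_cofactor n x) t / poly (pderiv (legendre n)) x) has_integral
        gl_weight n x) {-1..1}"
      using pderiv_legendre_root_nonzero[of n x] that by simp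
    from has_integral_of_real[OF this] have "(?l x has_integral of_real (gl_weight n x)) {-1..1}" .
    then show "integral {-1..1} (?l x) = of_real (gl_weight n x)" "?l x integrable_on {-1..1}"
      by (auto simp: has_integral_iff)
  qed
  have "gl_rem_fun n z = integral {-1..1} (\<lambda>t. of_real (poly (legendre n) t) / (z - of_real t) /
      cpoly (legendre n) z)"
    by (simp only: gl_rem_fun_eq legendre_cauchy_def integral_divide)
  also have "\<dots> = integral {-1..1} (\<lambda>t. 1 / (z - of_real t) - (\<Sum>x\<in>?R. 1 / (z - of_real x) * ?l x t))"
    using False by (intro integral_cong cauchy_kernel_interpolation z) auto
  also have "\<dots> = integral {-1..1} (\<lambda>t. 1 / (z - of_real t)) - integral {-1..1} (\<lambda>t. \<Sum>x\<in>?R. 1 / (z -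
      of_real x) * ?l x t)"
    using integrable_resolvent[OF z, of 1 1]
    by (intro integral_diff integrable_sum finite_legendre_roots integrable_on_mult_right l) auto
  also have "integral {-1..1} (\<lambda>t. \<Sum>x\<in>?R. 1 / (z - of_real x) * ?l x t) =
      (\<Sum>x\<in>?R. 1 / (z - of_real x) * of_real (gl_weight n x))"
  proof (subst integral_sum)
    show "(\<Sum>x\<in>?R. integral {-1..1} (\<lambda>t. 1 / (z - of_real x) * ?l x t)) =
        (\<Sum>x\<in>?R. 1 / (z - of_real x) * of_real (gl_weight n x))"
      by (intro sum.cong refl) (simp only: integral_mult_right l(1))
  qed (simp_all only: finite_legendre_roots integrable_on_mult_right l(2))
  finally show ?thesis by (simp add: complex_gl_remainder_def)
qed

lemma complex_gl_remainder_resolvent_deriv: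
  assumes z: "z \<notin> slit"
  shows "((\<lambda>z. complex_gl_remainder n (\<lambda>t. c / (z - of_real t) ^ Suc q)) has_field_derivative
     complex_gl_remainder n (\<lambda>t. - (of_nat (Suc q) * c) / (z - of_real t) ^ Suc (Suc q))) (at z)"
proof -
  obtain e where e: "e > 0" "ball z e \<subseteq> - slit"
    using open_not_slit z by (meson ComplI openE)
  have D: "((\<lambda>z. c / (z - of_real t) ^ Suc q) has_field_derivative - (of_nat (Suc q) * c) / (w -
      of_real t) ^ Suc (Suc q)) (at w within A)"
    if "w \<notin> slit" "t \<in> {-1..1}" for w t A
  proof -
    have nz: "w - of_real t \<noteq> 0" using not_slit_nonzero[OF that] .
    have "((\<lambda>z. c * inverse ((z - of_real t) ^ Suc q)) has_field_derivative
       c * - (inverse ((w - of_real t) ^ Suc q) * (of_nat (Suc q) * (w - of_real t) ^ q) * inverse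
           ((w - of_real t) ^ Suc q))) (at w within A)"
      by (rule derivative_eq_intros refl | use nz in simp)+
    note 1 = this
    have 2: "c * - (inverse (W ^ Suc q) * (N * W ^ q) * inverse (W ^ Suc q)) =
        - (N * c) / W ^ Suc (Suc q)"
      if "W \<noteq> 0" for W N :: complex
      using that by (simp add: divide_simps)
    show ?thesis using 1 unfolding 2[OF nz] divide_inverse[of c] .
  qed
  have "((\<lambda>z. integral (cbox (-1) 1) (\<lambda>t. c / (z - of_real t) ^ Suc q)) has_field_derivative
      integral (cbox (-1) 1) (\<lambda>t. - (of_nat (Suc q) * c) / (z - of_real t) ^ Suc (Suc q))) (at z
          within ball z e)"
  proof (rule leibniz_rule_field_derivative)
    show "((\<lambda>w. c / (w - of_real t) ^ Suc q) has_field_derivative - (of_nat (Suc q) * c) / (w -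
        of_real t) ^ Suc (Suc q)) (at w within ball z e)"
      if "w \<in> ball z e" "t \<in> cbox (-1) 1" for w t
    proof (rule D)
      show "w \<notin> slit" using that e(2) by blast
      show "t \<in> {-1..1}" using that by (simp add: cbox_interval)
    qed
    show "(\<lambda>t. c / (w - complex_of_real t) ^ Suc q) integrable_on cbox (-1) 1" if "w \<in> ball z e" for w
    proof -
      have "w \<notin> slit" using that e(2) by blast
      from integrable_resolvent[OF this] show ?thesis by (simp only: cbox_interval)
    qed
    show "continuous_on (ball z e \<times> cbox (-1) 1) (\<lambda>(w, t). - (of_nat (Suc q) * c) / (w -
        complex_of_real t) ^ Suc (Suc q))"
      unfolding split_def
    proof (intro continuous_intros ballI)
      fix x :: "complex \<times> real" assume "x \<in> ball z e \<times> cbox (-1) 1"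
      then have "fst x \<notin> slit" "snd x \<in> {-1..1}" using e(2) by (auto simp: cbox_interval)
      then show "(fst x - complex_of_real (snd x)) ^ Suc (Suc q) \<noteq> 0"
        using not_slit_nonzero[of "fst x" "snd x"] by simp
    qed
  qed (use e in auto)
  then have "((\<lambda>z. integral {-1..1} (\<lambda>t. c / (z - of_real t) ^ Suc q)) has_field_derivative
      integral {-1..1} (\<lambda>t. - (of_nat (Suc q) * c) / (z - of_real t) ^ Suc (Suc q))) (at z)"
    using e(1) by (simp add: at_within_open[of z "ball z e"] cbox_interval del: power_Suc)
  moreover have "((\<lambda>z. \<Sum>x | poly (legendre n) x =
      0. c / (z - of_real x) ^ Suc q * of_real (gl_weight n x)) has_field_derivative
     (\<Sum>x | poly (legendre n) x = 0. - (of_nat (Suc q) * c) / (z - of_real x) ^ Suc (Suc q) * of_real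
         (gl_weight n x))) (at z)"
  proof (intro DERIV_sum DERIV_cmult_right D z)
    show "x \<in> {-1..1}" if "x \<in> {x. poly (legendre n) x = 0}" for x
      using legendre_roots_interior[of n x] that by (simp add: abs_less_iff)
  qed
  ultimately show ?thesis unfolding complex_gl_remainder_def by (rule DERIV_diff)
qed

lemma higher_deriv_gl_rem_fun:
  assumes "z \<notin> slit"
  shows "(deriv ^^ q) (gl_rem_fun n) z = complex_gl_remainder n (\<lambda>t. (-1) ^ q * fact q / (z -
      of_real t) ^ Suc q)"
  using assms
proof (induction q arbitrary: z)
  case 0
  then show ?case by (simp add: gl_rem_fun_eq_remainder)
next
  case (Suc q)
  have "((\<lambda>z. (deriv ^^ q) (gl_rem_fun n) z) has_field_derivative
    complex_gl_remainder n (\<lambda>t. - (of_nat (Suc q) * ((-1) ^ q * fact q)) / (z - of_real t) ^ Suc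
        (Suc q))) (at z)"
    by (rule has_field_derivative_transform_within_open[OF complex_gl_remainder_resolvent_deriv[OF
        Suc.prems] open_not_slit])
       (use Suc in auto)
  from DERIV_imp_deriv[OF this] show ?case by (simp add: algebra_simps)
qed

lemma gl_rem_fun_holomorphic: "gl_rem_fun n holomorphic_on - slit"
proof (rule holomorphic_onI)
  fix z assume "z \<in> - slit"
  then have z: "z \<notin> slit" by simp
  have "(gl_rem_fun n has_field_derivative complex_gl_remainder n (\<lambda>t. - (of_nat (Suc 0) * 1) / (z -
      of_real t) ^ Suc (Suc 0))) (at z)"
    by (rule has_field_derivative_transform_within_open[OF complex_gl_remainder_resolvent_deriv[OF
        z] open_not_slit])
       (use z in \<open>auto simp: gl_rem_fun_eq_remainder\<close>)
  then show "gl_rem_fun n field_differentiable at z within - slit"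
    using field_differentiable_at_within field_differentiable_def by blast
qed

section \<open>Asymptotics of the derivatives\<close>

definition locally_uniform_limit ::
  "complex set \<Rightarrow> (nat \<Rightarrow> complex \<Rightarrow> complex) \<Rightarrow> (complex \<Rightarrow> complex) \<Rightarrow> bool" where
  "locally_uniform_limit S f g \<longleftrightarrow>
     (\<forall>z\<in>S. \<exists>e>0. ball z e \<subseteq> S \<and> uniform_limit (ball z e) f g sequentially)"

lemma locally_uniform_limit_tendsto:
  assumes "locally_uniform_limit S f g" "z \<in> S"
  shows "(\<lambda>n. f n z) \<longlonglongrightarrow> g z"
proof -
  obtain e where "e > 0" "uniform_limit (ball z e) f g sequentially"
    using assms unfolding locally_uniform_limit_def by blast
  then show ?thesis by (auto intro: tendsto_uniform_limitI)
qed

text \<open>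
  The Cauchy estimate on discs of fixed radius bounds the derivatives of \<open>h\<^sub>n\<close> uniformly in \<open>n\<close>, so
  that dividing them by \<open>N\<^sub>n\<close> makes them negligible.
\<close>
lemma locally_uniform_limit_log_deriv:
  fixes N :: "nat \<Rightarrow> real"
  assumes lim: "locally_uniform_limit S h H"
    and N: "filterlim N at_top sequentially"
    and \<phi>: "\<phi> holomorphic_on S" and H: "H holomorphic_on S" and h: "\<And>n. h n holomorphic_on S"
  shows "locally_uniform_limit S (\<lambda>n z. \<phi> z * h n z + deriv (h n) z / of_real (N n)) (\<lambda>z. \<phi> z * H z)"
  unfolding locally_uniform_limit_def
proof
  fix z assume "z \<in> S"
  then obtain e where e: "e > 0" "ball z e \<subseteq> S" and ul: "uniform_limit (ball z e) h H sequentially"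
    using lim unfolding locally_uniform_limit_def by blast
  \<comment> \<open>Discs of radius \<open>\<delta>\<close> about points of \<open>ball z \<delta>\<close> stay in \<open>cball z (2 * \<delta>)\<close>, inside \<open>ball z e\<close>.\<close>
  define \<delta> where "\<delta> = e / 4"
  have \<delta>: "\<delta> > 0" using e by (simp add: \<delta>_def)
  have sub: "cball z (2 * \<delta>) \<subseteq> ball z e" using e by (auto simp: \<delta>_def)
  have bdd: "bounded (f ` cball z (2 * \<delta>))" if "f holomorphic_on S" for f :: "complex \<Rightarrow> complex"
    using that sub e(2) compact_imp_bounded compact_continuous_image compact_cball
    by (meson continuous_on_subset holomorphic_on_imp_continuous_on order_trans)
  have ball_sub: "ball z \<delta> \<subseteq> cball z (2 * \<delta>)" using \<delta> by auto
  obtain M where M: "\<And>x. x \<in> cball z (2 * \<delta>) \<Longrightarrow> norm (H x) \<le> M"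
    using bdd[OF H] unfolding bounded_iff by blast
  have "\<forall>\<^sub>F n in sequentially. \<forall>x\<in>ball z e. dist (h n x) (H x) < 1"
    using ul by (rule uniform_limitD) simp
  then have hM: "\<forall>\<^sub>F n in sequentially. \<forall>x\<in>cball z (2 * \<delta>). norm (h n x) \<le> M + 1"
  proof eventually_elim
    case (elim n)
    show ?case
    proof
      fix x assume x: "x \<in> cball z (2 * \<delta>)"
      then have "norm (h n x - H x) < 1" using elim sub by (auto simp: dist_norm)
      then show "norm (h n x) \<le> M + 1" using M[OF x] norm_triangle_sub[of "h n x" "H x"] by linarith
    qed
  qed
  have deriv0: "uniform_limit (ball z \<delta>) (\<lambda>n x. deriv (h n) x / of_real (N n)) (\<lambda>_. 0) sequentially"
  proof (rule uniform_limitI)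
    fix \<epsilon> :: real assume \<epsilon>: "\<epsilon> > 0"
    have "\<forall>\<^sub>F n in sequentially. N n > max 0 ((M + 1) / \<delta> / \<epsilon>)"
      using N unfolding filterlim_at_top_dense by blast
    with hM show "\<forall>\<^sub>F n in sequentially. \<forall>x\<in>ball z \<delta>. dist (deriv (h n) x / of_real (N n)) 0 < \<epsilon>"
    proof eventually_elim
      case (elim n)
      show ?case
      proof
        fix x assume x: "x \<in> ball z \<delta>"
        have csub: "cball x \<delta> \<subseteq> cball z (2 * \<delta>)"
        proof
          fix y assume "y \<in> cball x \<delta>"
          then show "y \<in> cball z (2 * \<delta>)" using x dist_triangle[of z y x] by simp
        qed
        have hol: "h n holomorphic_on cball x \<delta>"
          using h csub sub e(2) by (meson holomorphic_on_subset order_trans)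
        have "norm ((deriv ^^ 1) (h n) x) \<le> fact 1 * (M + 1) / \<delta> ^ 1"
        proof (rule Cauchy_inequality)
          show "h n holomorphic_on ball x \<delta>" by (rule holomorphic_on_subset[OF hol]) auto
          show "continuous_on (cball x \<delta>) (h n)" by (rule holomorphic_on_imp_continuous_on[OF hol])
          show "norm (h n y) \<le> M + 1" if "norm (x - y) = \<delta>" for y
          proof -
            have "y \<in> cball x \<delta>" using that by (simp add: dist_norm)
            then show ?thesis using elim(1) csub by blast
          qed
        qed (rule \<delta>)
        then have "norm (deriv (h n) x) \<le> (M + 1) / \<delta>" by simp
        also have "\<dots> < \<epsilon> * N n" using elim(2) \<epsilon> \<delta> by (simp add: divide_less_eq mult_ac)
        finally show "dist (deriv (h n) x / of_real (N n)) 0 < \<epsilon>"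
          using elim(2) by (simp add: norm_divide divide_less_eq)
      qed
    qed
  qed
  have small: "ball z \<delta> \<subseteq> ball z e" using ball_sub sub by blast
  have "uniform_limit (ball z \<delta>) (\<lambda>n x. \<phi> x * h n x) (\<lambda>x. \<phi> x * H x) sequentially"
    using bdd[OF \<phi>] bdd[OF H] ball_sub
    by (intro uniform_lim_mult uniform_limit_const uniform_limit_on_subset[OF ul small])
       (auto intro: bounded_subset image_mono)
  from uniform_limit_add[OF this deriv0]
  have "uniform_limit (ball z \<delta>) (\<lambda>n z. \<phi> z * h n z + deriv (h n) z / of_real (N n)) (\<lambda>z. \<phi> z * H z)
      sequentially"
    by simp
  then show "\<exists>e>0. ball z e \<subseteq> S \<and> uniform_limit (ball z e) (\<lambda>n z. \<phi> z * h n z + deriv (h n) z /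
      of_real (N n)) (\<lambda>z. \<phi> z * H z) sequentially"
    using \<delta> small e(2) by blast
qed

text \<open>
  If \<open>E\<^sub>n' = N\<^sub>n \<phi> E\<^sub>n\<close>, then \<open>(h\<^sub>n E\<^sub>n)' = N\<^sub>n (\<phi> h\<^sub>n + h\<^sub>n' / N\<^sub>n) E\<^sub>n\<close> has the same shape as
  \<open>h\<^sub>n E\<^sub>n\<close>, with \<open>h\<^sub>n\<close> replaced by a sequence that converges to \<open>\<phi> H\<close>. For this reason the induction is
  over all sequences \<open>h\<^sub>n\<close> simultaneously and takes the innermost derivative first.
\<close>
lemma higher_deriv_exponential_asymptotics:
  fixes N :: "nat \<Rightarrow> real"
  assumes S: "open S" "z \<in> S"
    and N: "filterlim N at_top sequentially" "\<And>n. N n \<noteq> 0"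
    and \<phi>: "\<phi> holomorphic_on S"
    and E: "\<And>n z. z \<in> S \<Longrightarrow> (E n has_field_derivative of_real (N n) * \<phi> z * E n z) (at z)"
    and lim: "locally_uniform_limit S h H"
    and H: "H holomorphic_on S" and h: "\<And>n. h n holomorphic_on S"
    and E0: "\<And>n. E n z \<noteq> 0"
  shows "(\<lambda>n. (deriv ^^ q) (\<lambda>z. h n z * E n z) z / (of_real (N n) ^ q * E n z)) \<longlonglongrightarrow> \<phi> z ^ q * H z"
  using lim H h
proof (induction q arbitrary: h H)
  case 0
  then show ?case using locally_uniform_limit_tendsto[OF 0(1) S(2)] E0 by simp
next
  case (Suc q)
  define h' where "h' n z = \<phi> z * h n z + deriv (h n) z / of_real (N n)" for n z
  have E_hol: "E n holomorphic_on S" for n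
    using E S(1) by (meson field_differentiable_def holomorphic_onI field_differentiable_at_within)
  have h'_hol: "h' n holomorphic_on S" for n
    unfolding h'_def[abs_def] using N(2)
    by (intro holomorphic_intros \<phi> Suc.prems holomorphic_deriv S(1)) auto
  have IH: "(\<lambda>n. (deriv ^^ q) (\<lambda>z. h' n z * E n z) z / (of_real (N n) ^ q * E n z)) \<longlonglongrightarrow> \<phi> z ^ q * (\<phi> z
      * H z)"
  proof (rule Suc.IH)
    show "locally_uniform_limit S h' (\<lambda>z. \<phi> z * H z)"
      unfolding h'_def[abs_def] by (rule locally_uniform_limit_log_deriv[OF Suc.prems(1) N(1) \<phi>
          Suc.prems(2,3)])
    show "(\<lambda>z. \<phi> z * H z) holomorphic_on S" by (intro holomorphic_intros \<phi> Suc.prems)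
  qed (rule h'_hol)
  have step: "(deriv ^^ Suc q) (\<lambda>z. h n z * E n z) z =
      of_real (N n) * (deriv ^^ q) (\<lambda>z. h' n z * E n z) z" for n
  proof -
    have D: "deriv (\<lambda>z. h n z * E n z) x = of_real (N n) * (h' n x * E n x)" if x: "x \<in> S" for x
    proof -
      have "(h n has_field_derivative deriv (h n) x) (at x)"
        using Suc.prems(3) S(1) x by (rule holomorphic_derivI)
      from DERIV_mult[OF this E[OF x]] have "deriv (\<lambda>z. h n z * E n z) x =
          deriv (h n) x * E n x + of_real (N n) * \<phi> x * E n x * h n x"
        by (rule DERIV_imp_deriv)
      then show ?thesis using N(2)[of n] by (simp add: h'_def field_simps)
    qed
    have prod_hol: "(\<lambda>z. h' n z * E n z) holomorphic_on S"
      by (intro holomorphic_intros h'_hol E_hol)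
    have "(deriv ^^ Suc q) (\<lambda>z. h n z * E n z) z = (deriv ^^ q) (deriv (\<lambda>z. h n z * E n z)) z"
      by (simp only: funpow_Suc_right o_def)
    also have "\<dots> = (deriv ^^ q) (\<lambda>z. of_real (N n) * (h' n z * E n z)) z"
      using D S
      by (intro higher_deriv_transform_within_open[where S = S])
         (auto intro!: holomorphic_intros holomorphic_deriv Suc.prems h'_hol E_hol)
    also have "\<dots> = of_real (N n) * (deriv ^^ q) (\<lambda>z. h' n z * E n z) z"
      by (rule higher_deriv_cmult[OF prod_hol S(2,1)])
    finally show ?thesis .
  qed
  have "(deriv ^^ Suc q) (\<lambda>z. h n z * E n z) z / (of_real (N n) ^ Suc q * E n z) =
      (deriv ^^ q) (\<lambda>z. h' n z * E n z) z / (of_real (N n) ^ q * E n z)" for n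
    unfolding step using N(2)[of n] by simp
  then show ?case using IH by (simp only: power_Suc mult_ac)
qed

definition gl_deriv_leading :: "nat \<Rightarrow> complex \<Rightarrow> nat \<Rightarrow> complex" where
  "gl_deriv_leading q z n = (- (of_nat (2 * n + 1) / sqrt_branch z)) ^ q *
     (2 * of_real pi / (z + sqrt_branch z) ^ (2 * n + 1))"

lemma gl_deriv_leading_nonzero:
  assumes "z \<notin> slit"
  shows "gl_deriv_leading q z n \<noteq> 0"
proof -
  have "of_nat (2 * n + 1) \<noteq> (0 :: complex)" unfolding of_nat_eq_0_iff by simp
  then show ?thesis
    using sqrt_branch_nonzero[OF assms] joukowski_inv_nonzero[OF assms]
    unfolding gl_deriv_leading_def joukowski_inv_def[symmetric] by simp
qed

lemma higher_deriv_gl_rem_fun_asymp: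
  assumes z: "z \<notin> slit"
  shows "(\<lambda>n. (deriv ^^ q) (gl_rem_fun n) z) \<sim>[sequentially] gl_deriv_leading q z"
proof -
  define u where "u = joukowski_inv"
  define N where "N n = real (2 * n + 1)" for n
  define E where "E n z = inverse (u z) ^ (2 * n + 1)" for n z
  define h where "h n z = gl_rem_fun n z * u z ^ (2 * n + 1)" for n z
  have u0: "u x \<noteq> 0" if "x \<in> - slit" for x
    using joukowski_inv_nonzero[of x] that by (simp add: u_def)
  have s0: "sqrt_branch x \<noteq> 0" if "x \<in> - slit" for x
    using sqrt_branch_nonzero[of x] that by simp
  have "(\<lambda>n. (deriv ^^ q) (\<lambda>z. h n z * E n z) z / (of_real (N n) ^ q * E n z)) \<longlonglongrightarrow>
      (- 1 / sqrt_branch z) ^ q * of_real (2 * pi)"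
  proof (rule higher_deriv_exponential_asymptotics[where S = "- slit" and \<phi> =
      "\<lambda>z. - 1 / sqrt_branch z" and H = "\<lambda>_. of_real (2 * pi)"])
    show "filterlim N at_top sequentially" unfolding N_def by real_asymp
    show "N n \<noteq> 0" for n by (simp add: N_def)
    show "(\<lambda>z. - 1 / sqrt_branch z) holomorphic_on - slit"
      by (intro holomorphic_intros sqrt_branch_holomorphic s0)
    show "locally_uniform_limit (- slit) h (\<lambda>_. of_real (2 * pi))"
      using scaled_gl_rem_fun_locally_uniform
      unfolding locally_uniform_limit_def h_def u_def by blast
    show "h n holomorphic_on - slit" for n
      unfolding h_def u_def by (intro holomorphic_intros gl_rem_fun_holomorphic
          joukowski_inv_holomorphic)
    show "(E n has_field_derivative of_real (N n) * (- 1 / sqrt_branch x) * E n x) (at x)" if x: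
        "x \<in> - slit" for n x
    proof -
      have "(u has_field_derivative u x / sqrt_branch x) (at x)"
        unfolding u_def using x by (intro joukowski_inv_deriv) simp
      then have D: "((\<lambda>z. inverse (u z) ^ (2 * n + 1)) has_field_derivative
          of_nat (2 * n + 1) * (- (inverse (u x) * (u x / sqrt_branch x) * inverse (u x)) *
            inverse (u x) ^ (2 * n + 1 - Suc 0))) (at x)"
        by (intro DERIV_power DERIV_inverse' u0 x)
      have eq: "of_nat (2 * n + 1) * (- (U' * (U / s) * U') * U' ^ (2 * n + 1 - Suc 0)) =
          of_real (N n) * (- 1 / s) * U' ^ (2 * n + 1)"
        if "U' * U = 1" for U' U s :: complex
      proof -
        have "U' * (U / s) * U' = (U' * U) * U' / s" by simp
        also have "\<dots> = U' / s" by (simp only: that mult_1_left)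
        finally have "U' * (U / s) * U' = U' / s" .
        then show ?thesis by (simp only:) (simp add: N_def)
      qed
      have "inverse (u x) * u x = 1" using u0[OF x] by simp
      from D show ?thesis unfolding E_def[abs_def] eq[OF \<open>inverse (u x) * u x = 1\<close>] .
    qed
    show "E n z \<noteq> 0" for n using u0 z by (simp add: E_def)
  qed (use z open_not_slit in auto)
  moreover have "(deriv ^^ q) (\<lambda>z. h n z * E n z) z = (deriv ^^ q) (gl_rem_fun n) z" for n
  proof (rule higher_deriv_transform_within_open[where S = "- slit"])
    show eq: "h n x * E n x = gl_rem_fun n x" if "x \<in> - slit" for x
    proof -
      have "h n x * E n x = gl_rem_fun n x * (u x * inverse (u x)) ^ (2 * n + 1)"
        by (simp only: h_def E_def power_mult_distrib mult.assoc)
      then show ?thesis using u0[OF that] by simp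
    qed
    show "gl_rem_fun n holomorphic_on - slit" by (rule gl_rem_fun_holomorphic)
    then show "(\<lambda>z. h n z * E n z) holomorphic_on - slit"
      by (rule holomorphic_transform) (simp add: eq)
  qed (use z open_not_slit in auto)
  ultimately have lim: "(\<lambda>n. (deriv ^^ q) (gl_rem_fun n) z / (of_real (N n) ^ q * E n z)) \<longlonglongrightarrow>
      (- 1 / sqrt_branch z) ^ q * of_real (2 * pi)" by simp
  have c0: "(- 1 / sqrt_branch z) ^ q * of_real (2 * pi) \<noteq> 0" using s0[of z] z by simp
  have leading: "gl_deriv_leading q z n = of_real (N n) ^ q * E n z * ((- 1 / sqrt_branch z) ^ q *
      of_real (2 * pi))" for n
  proof -
    have "- (of_nat (2 * n + 1) / sqrt_branch z) = of_real (N n) * (- 1 / sqrt_branch z)"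
      by (simp add: N_def)
    then have "(- (of_nat (2 * n + 1) / sqrt_branch z)) ^ q =
        of_real (N n) ^ q * (- 1 / sqrt_branch z) ^ q"
      by (simp only: power_mult_distrib)
    moreover have "2 * of_real pi / (z + sqrt_branch z) ^ (2 * n + 1) = E n z * of_real (2 * pi)"
      by (simp add: E_def u_def joukowski_inv_def power_inverse divide_inverse)
    ultimately show ?thesis unfolding gl_deriv_leading_def by (simp only: mult_ac)
  qed
  show ?thesis
  proof (rule asymp_equivI')
    have "(\<lambda>n. (deriv ^^ q) (gl_rem_fun n) z / (of_real (N n) ^ q * E n z) / ((- 1 / sqrt_branch z)
        ^ q * of_real (2 * pi))) \<longlonglongrightarrow>
      ((- 1 / sqrt_branch z) ^ q * of_real (2 * pi)) / ((- 1 / sqrt_branch z) ^ q * of_real (2 * pi))"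
      by (intro tendsto_divide lim tendsto_const c0)
    then show "(\<lambda>n. (deriv ^^ q) (gl_rem_fun n) z / gl_deriv_leading q z n) \<longlonglongrightarrow> 1"
      unfolding leading divide_self[OF c0] divide_divide_eq_left .
  qed
qed

section \<open>Partial fractions and the remainder of the rational function\<close>

text \<open>
  The relation \<open>X Y = (X - Y) / d\<close> holds for \<open>X = 1 / (x - \<alpha>)\<close> and \<open>Y = 1 / (x - \<beta>)\<close> with
  \<open>d = \<alpha> - \<beta>\<close>. It lowers one of the exponents of \<open>X\<^sup>m Y\<^sup>n\<close>, at the cost of a factor \<open>1 / d\<close>, until one
  of the powers has gone. Up to sign, the coefficients of
  the highest powers are the products of these factors.
\<close>
lemma partial_fractions_product:
  fixes d :: complex
  assumes d: "d \<noteq> 0" and "m > 0 \<or> n > 0"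
  shows "\<exists>A B. A m = 1 / d ^ n \<and> B n = (-1) ^ m / d ^ m \<and>
    (\<forall>X Y. X * Y = (X - Y) / d \<longrightarrow>
       X ^ m * Y ^ n = (\<Sum>j=1..m. A j * X ^ j) + (\<Sum>j=1..n. B j * Y ^ j))"
  using assms(2)
proof (induction "m + n" arbitrary: m n rule: less_induct)
  case less
  have single: "(\<Sum>j=1..k. (if j = k then 1 else 0) * X ^ j) = X ^ k" if "k > 0" for k and X :: complex
    using that by (subst sum.remove[of _ k]) auto
  consider "n = 0" "m > 0" | "m = 0" "n > 0" | m' n' where "m = Suc m'" "n = Suc n'"
    using less.prems by (metis not0_implies_Suc gr0I)
  then show ?case
  proof cases
    case 1
    then show ?thesis
      by (intro exI[of _ "\<lambda>j. if j = m then 1 else 0"] exI[of _ "\<lambda>_. (-1) ^ m / d ^ m"])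
         (use single in auto)
  next
    case 2
    then show ?thesis
      by (intro exI[of _ "\<lambda>_. 1 / d ^ n"] exI[of _ "\<lambda>j. if j = n then 1 else 0"])
         (use single in auto)
  next
    case 3
    obtain A1 B1 where 1: "A1 m = 1 / d ^ n'"
      "\<And>X Y. X * Y = (X - Y) / d \<Longrightarrow>
         X ^ m * Y ^ n' = (\<Sum>j=1..m. A1 j * X ^ j) + (\<Sum>j=1..n'. B1 j * Y ^ j)"
      using less.hyps[of m n'] 3 by auto
    obtain A2 B2 where 2: "B2 n = (-1) ^ m' / d ^ m'"
      "\<And>X Y. X * Y = (X - Y) / d \<Longrightarrow>
         X ^ m' * Y ^ n = (\<Sum>j=1..m'. A2 j * X ^ j) + (\<Sum>j=1..n. B2 j * Y ^ j)"
      using less.hyps[of m' n] 3 by auto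
    define A where "A j = (A1 j - (if j \<le> m' then A2 j else 0)) / d" for j
    define B where "B j = ((if j \<le> n' then B1 j else 0) - B2 j) / d" for j
    have "X ^ m * Y ^ n = (\<Sum>j=1..m. A j * X ^ j) + (\<Sum>j=1..n. B j * Y ^ j)"
      if XY: "X * Y = (X - Y) / d" for X Y
    proof -
      have "X ^ m * Y ^ n = X ^ m' * Y ^ n' * (X * Y)" by (simp add: 3)
      also have "\<dots> = (X ^ m * Y ^ n' - X ^ m' * Y ^ n) / d"
        unfolding XY by (simp add: 3 algebra_simps)
      also have "\<dots> = ((\<Sum>j=1..m. A1 j * X ^ j) - (\<Sum>j=1..m'. A2 j * X ^ j)) / d +
          ((\<Sum>j=1..n'. B1 j * Y ^ j) - (\<Sum>j=1..n. B2 j * Y ^ j)) / d"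
        unfolding 1(2)[OF XY] 2(2)[OF XY] by (simp add: diff_divide_distrib add_divide_distrib)
      also have "(\<Sum>j=1..m'. A2 j * X ^ j) = (\<Sum>j=1..m. (if j \<le> m' then A2 j else 0) * X ^ j)"
        unfolding 3 by (simp add: sum.cl_ivl_Suc)
      also have "(\<Sum>j=1..n'. B1 j * Y ^ j) = (\<Sum>j=1..n. (if j \<le> n' then B1 j else 0) * Y ^ j)"
        unfolding 3 by (simp add: sum.cl_ivl_Suc)
      also have "((\<Sum>j=1..m. A1 j * X ^ j) - (\<Sum>j=1..m. (if j \<le> m' then A2 j else 0) * X ^ j)) / d =
          (\<Sum>j=1..m. A j * X ^ j)"
        unfolding A_def sum_subtractf[symmetric] sum_divide_distrib
        by (intro sum.cong refl) (simp add: left_diff_distrib diff_divide_distrib)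
      also have "((\<Sum>j=1..n. (if j \<le> n' then B1 j else 0) * Y ^ j) - (\<Sum>j=1..n. B2 j * Y ^ j)) / d =
          (\<Sum>j=1..n. B j * Y ^ j)"
        unfolding B_def sum_subtractf[symmetric] sum_divide_distrib
        by (intro sum.cong refl) (simp add: left_diff_distrib diff_divide_distrib)
      finally show ?thesis .
    qed
    moreover have "A m = 1 / d ^ n" "B n = (-1) ^ m / d ^ m"
      using 1(1) 2(1) by (simp_all add: A_def B_def 3)
    ultimately show ?thesis by blast
  qed
qed

text \<open>
  At the poles \<open>z\<^sub>0\<close> and \<open>cnj z\<^sub>0\<close> the two factors are conjugate for real \<open>x\<close>. As the function is
  real, taking real parts lets the terms at \<open>cnj z\<^sub>0\<close> be replaced by their conjugates, which are terms
  at \<open>z\<^sub>0\<close>; the two leading coefficients are conjugate and add up.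
\<close>
lemma partial_fractions_real:
  fixes a b :: real
  assumes p: "p \<ge> 1" and b: "b > 0"
  defines "z0 \<equiv> Complex a b"
  obtains D where "D p = 2 / (2 * \<i> * of_real b) ^ p"
    and "\<And>x. 1 / ((x - a)\<^sup>2 + b\<^sup>2) ^ p = Re (\<Sum>j=1..p. D j / (of_real x - z0) ^ j)"
proof -
  define d where "d = 2 * \<i> * complex_of_real b"
  have d: "d \<noteq> 0" using b by (simp add: d_def)
  obtain A B where AB: "A p = 1 / d ^ p" "B p = (-1) ^ p / d ^ p"
    "\<And>X Y. X * Y = (X - Y) / d \<Longrightarrow>
       X ^ p * Y ^ p = (\<Sum>j=1..p. A j * X ^ j) + (\<Sum>j=1..p. B j * Y ^ j)"
    using partial_fractions_product[OF d, of p p] p by auto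
  define D where "D j = A j + cnj (B j)" for j
  have "cnj d = - d" by (simp add: d_def)
  then have "cnj (B p) = 1 / d ^ p"
    using d by (simp add: AB(2) power_minus[of d])
  then have "D p = 2 / (2 * \<i> * of_real b) ^ p" by (simp add: D_def AB(1) d_def)
  moreover have "1 / ((x - a)\<^sup>2 + b\<^sup>2) ^ p = Re (\<Sum>j=1..p. D j / (of_real x - z0) ^ j)" for x
  proof -
    define X where "X = 1 / (of_real x - z0)"
    define Y where "Y = cnj X"
    have nz: "of_real x - z0 \<noteq> 0" using b by (simp add: z0_def complex_eq_iff)
    have Y: "Y = 1 / (of_real x - cnj z0)" by (simp add: Y_def X_def)
    have nz': "of_real x - cnj z0 \<noteq> 0" using b by (simp add: z0_def complex_eq_iff)
    have dz: "d = z0 - cnj z0" by (simp add: d_def z0_def complex_eq_iff)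
    have "X - Y = (z0 - cnj z0) * (X * Y)"
      unfolding X_def Y using nz nz' by (simp add: divide_simps)
    then have XY: "X * Y = (X - Y) / d" using d by (simp add: dz[symmetric])
    have prod: "X * Y = of_real (1 / ((x - a)\<^sup>2 + b\<^sup>2))"
    proof -
      have "(of_real x - z0) * (of_real x - cnj z0) = of_real ((x - a)\<^sup>2 + b\<^sup>2)"
        by (simp add: z0_def complex_eq_iff power2_eq_square algebra_simps)
      then show ?thesis by (simp add: X_def Y)
    qed
    have "complex_of_real (1 / ((x - a)\<^sup>2 + b\<^sup>2) ^ p) = (X * Y) ^ p"
      unfolding prod by (simp add: power_one_over)
    also have "\<dots> = (\<Sum>j=1..p. A j * X ^ j) + (\<Sum>j=1..p. B j * Y ^ j)"
      by (simp add: power_mult_distrib AB(3)[OF XY])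
    finally have "1 / ((x - a)\<^sup>2 + b\<^sup>2) ^ p = Re (\<Sum>j=1..p. A j * X ^ j) + Re (\<Sum>j=1..p. B j * Y ^ j)"
      by (metis Re_complex_of_real plus_complex.sel(1))
    also have "Re (\<Sum>j=1..p. B j * Y ^ j) = Re (cnj (\<Sum>j=1..p. B j * Y ^ j))"
      by (rule cnj.sel(1)[symmetric])
    also have "cnj (\<Sum>j=1..p. B j * Y ^ j) = (\<Sum>j=1..p. cnj (B j) * X ^ j)" by (simp add: Y_def)
    finally have "1 / ((x - a)\<^sup>2 + b\<^sup>2) ^ p = Re ((\<Sum>j=1..p. A j * X ^ j) + (\<Sum>j=1..p. cnj (B j) * X ^
        j))"
      by simp
    also have "(\<Sum>j=1..p. A j * X ^ j) + (\<Sum>j=1..p. cnj (B j) * X ^ j) =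
        (\<Sum>j=1..p. D j / (of_real x - z0) ^ j)"
      by (simp add: D_def X_def sum.distrib[symmetric] power_one_over add_divide_distrib)
    finally show ?thesis .
  qed
  ultimately show thesis by (rule that)
qed

lemma complex_gl_remainder_sum:
  assumes "finite J" "\<And>j. j \<in> J \<Longrightarrow> f j integrable_on {-1..1}"
  shows "complex_gl_remainder n (\<lambda>t. \<Sum>j\<in>J. c j * f j t) = (\<Sum>j\<in>J. c j * complex_gl_remainder n (f j))"
proof -
  have "integral {-1..1} (\<lambda>t. \<Sum>j\<in>J. c j * f j t) = (\<Sum>j\<in>J. c j * integral {-1..1} (f j))"
    using assms by (subst integral_sum) (simp_all add: integrable_on_mult_right)
  moreover have "(\<Sum>x | poly (legendre n) x = 0. (\<Sum>j\<in>J. c j * f j x) * of_real (gl_weight n x)) =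
     (\<Sum>j\<in>J. c j * (\<Sum>x | poly (legendre n) x = 0. f j x * of_real (gl_weight n x)))"
    unfolding sum_distrib_right sum_distrib_left by (subst sum.swap) (simp add: mult.assoc)
  ultimately show ?thesis
    by (simp add: complex_gl_remainder_def sum_subtractf right_diff_distrib)
qed

lemma gl_remainder_Re:
  assumes "f integrable_on {-1..1}"
  shows "gl_remainder n (\<lambda>t. Re (f t)) = Re (complex_gl_remainder n f)"
proof -
  have "integral {-1..1} (\<lambda>t. Re (f t)) = Re (integral {-1..1} f)"
    using integral_linear[OF assms bounded_linear_Re] by (simp add: o_def)
  then show ?thesis
    by (simp add: gl_remainder_def gl_rule_def complex_gl_remainder_def)
qed

lemma Complex_not_slit:
  assumes "b > 0"
  shows "Complex a b \<notin> slit"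
proof
  assume "Complex a b \<in> slit"
  then obtain u where "Complex a b = (1 - u) *\<^sub>R (-1) + u *\<^sub>R 1" by (auto simp: closed_segment_def)
  from arg_cong[OF this, of Im] show False using assms by simp
qed

lemma gl_remainder_expansion:
  fixes a b :: real
  assumes p: "p \<ge> 1" and b: "b > 0"
  defines "z0 \<equiv> Complex a b"
  obtains C where "C (p - 1) = 2 / ((2 * \<i> * of_real b) ^ p * fact (p - 1))"
    and "\<And>n. gl_remainder n (\<lambda>x. 1 / ((x - a)\<^sup>2 + b\<^sup>2) ^ p) =
           - Re (\<Sum>q<p. C q * (deriv ^^ q) (gl_rem_fun n) z0)"
proof -
  obtain D where D: "D p = 2 / (2 * \<i> * of_real b) ^ p"
      "\<And>x. 1 / ((x - a)\<^sup>2 + b\<^sup>2) ^ p = Re (\<Sum>j=1..p. D j / (of_real x - z0) ^ j)"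
    using partial_fractions_real[OF p b] unfolding z0_def by blast
  define C where "C q = D (Suc q) / fact q" for q
  have z0: "z0 \<notin> slit" unfolding z0_def by (rule Complex_not_slit[OF b])
  define f where "f q t = (-1) ^ q * fact q / (z0 - complex_of_real t) ^ Suc q" for q t
  have f: "f q integrable_on {-1..1}" for q
    unfolding f_def[abs_def] by (rule integrable_resolvent[OF z0])
  have sum_eq: "(\<Sum>j=1..p. D j / (of_real x - z0) ^ j) = (\<Sum>q<p. - C q * f q x)" for x
  proof -
    have "(\<Sum>j=1..p. D j / (of_real x - z0) ^ j) = (\<Sum>q<p. D (Suc q) / (of_real x - z0) ^ Suc q)"
      by (rule sum.reindex_bij_witness[of _ Suc "\<lambda>j. j - 1"]) auto
    also have "\<dots> = (\<Sum>q<p. - C q * f q x)"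
    proof (intro sum.cong refl)
      fix q
      have "(of_real x - z0) ^ Suc q = (- 1) ^ Suc q * (z0 - of_real x) ^ Suc q"
        by (simp only: power_mult_distrib[symmetric]) simp
      then have "D (Suc q) / (of_real x - z0) ^ Suc q =
          D (Suc q) * (- 1) ^ Suc q / (z0 - of_real x) ^ Suc q"
        by (simp add: divide_simps flip: power_mult_distrib)
      then show "D (Suc q) / (of_real x - z0) ^ Suc q = - C q * f q x"
        by (simp add: C_def f_def)
    qed
    finally show ?thesis .
  qed
  have "gl_remainder n (\<lambda>x. 1 / ((x - a)\<^sup>2 + b\<^sup>2) ^ p) =
      - Re (\<Sum>q<p. C q * (deriv ^^ q) (gl_rem_fun n) z0)" for n
  proof -
    have "gl_remainder n (\<lambda>x. 1 / ((x - a)\<^sup>2 + b\<^sup>2) ^ p) =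
        Re (complex_gl_remainder n (\<lambda>x. \<Sum>q<p. - C q * f q x))"
      unfolding D(2) sum_eq
      by (intro gl_remainder_Re integrable_sum integrable_on_mult_right f) auto
    also have "complex_gl_remainder n (\<lambda>x. \<Sum>q<p. - C q * f q x) =
        (\<Sum>q<p. - C q * complex_gl_remainder n (f q))"
      by (intro complex_gl_remainder_sum f) auto
    also have "\<dots> = - (\<Sum>q<p. C q * (deriv ^^ q) (gl_rem_fun n) z0)"
      unfolding higher_deriv_gl_rem_fun[OF z0] f_def by (simp add: sum_negf)
    finally show ?thesis by simp
  qed
  moreover have "C (p - 1) = 2 / ((2 * \<i> * of_real b) ^ p * fact (p - 1))"
    using p D(1) by (simp add: C_def)
  ultimately show thesis by (rule that[rotated])
qed

section \<open>Dominance of the highest derivative\<close>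

text \<open>
  Replaces the distinction between odd and even \<open>p\<close> by division by \<open>i\<^sup>p\<close>, which is \<open>1\<close> or \<open>i\<close> up to
  sign.
\<close>
lemma gl_part_eq_Re: "gl_part p w = \<bar>Re (w / \<i> ^ p)\<bar>"
proof -
  have pow: "\<i> ^ (2 * k) = (-1) ^ k" for k by (simp add: power_mult)
  have sign: "(-1 :: complex) ^ k = 1 \<or> (-1 :: complex) ^ k = -1" for k
    by (cases "even k") auto
  show ?thesis
  proof (cases "even p")
    case True
    then obtain k where "p = 2 * k" by (elim evenE)
    then show ?thesis using sign[of k] True by (auto simp: gl_part_def pow)
  next
    case False
    then obtain k where "p = 2 * k + 1" by (elim oddE)
    then show ?thesis using sign[of k] False by (auto simp: gl_part_def pow)
  qed
qed

lemma gl_part_scale: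
  fixes b :: real
  assumes b: "b > 0"
  shows "\<bar>Re (2 / ((2 * \<i> * of_real b) ^ p * fact (p - 1)) * w)\<bar> =
           2 / (fact (p - 1) * (2 * b) ^ p) * gl_part p w"
proof -
  have "2 / ((2 * \<i> * of_real b) ^ p * fact (p - 1)) * w =
      of_real (2 / (fact (p - 1) * (2 * b) ^ p)) * (w / \<i> ^ p)"
    by (simp add: power_mult_distrib)
  then have "Re (2 / ((2 * \<i> * of_real b) ^ p * fact (p - 1)) * w) =
      2 / (fact (p - 1) * (2 * b) ^ p) * Re (w / \<i> ^ p)"
    by (simp only: Re_complex_of_real times_complex.sel(1) Im_complex_of_real mult_zero_left diff_zero)
  then show ?thesis using b by (simp add: gl_part_eq_Re abs_mult)
qed

text \<open>
  The leading terms of consecutive derivatives differ by the factor \<open>- (2n+1) / \<surd>(z\<^sup>2 - 1)\<close>.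
\<close>
lemma gl_deriv_lower_order:
  assumes z: "z \<notin> slit" and "q < r"
  shows "(\<lambda>n. of_nat n * (deriv ^^ q) (gl_rem_fun n) z) \<in> O(\<lambda>n. (deriv ^^ r) (gl_rem_fun n) z)"
proof -
  have T: "(\<lambda>n. (deriv ^^ j) (gl_rem_fun n) z) \<in> \<Theta>(gl_deriv_leading j z)" for j
    by (rule asymp_equiv_imp_bigtheta[OF higher_deriv_gl_rem_fun_asymp[OF z]])
  have "(\<lambda>n. of_nat n * gl_deriv_leading q z n) \<in> O(gl_deriv_leading r z)"
  proof (rule bigoI)
    show "\<forall>\<^sub>F n in sequentially. norm (of_nat n * gl_deriv_leading q z n) \<le>
        norm (sqrt_branch z) ^ (r - q) * norm (gl_deriv_leading r z n)"
    proof (intro always_eventually allI)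
      fix n
      define w where "w = - (of_nat (2 * n + 1) / sqrt_branch z)"
      have "real n \<le> real (2 * n + 1) ^ 1" by simp
      also have "\<dots> \<le> real (2 * n + 1) ^ (r - q)" using assms(2) by (intro power_increasing) auto
      also have "\<dots> = norm (sqrt_branch z) ^ (r - q) * norm w ^ (r - q)"
        using sqrt_branch_nonzero[OF z]
        by (simp add: w_def norm_divide power_divide norm_of_nat del: of_nat_add of_nat_mult of_nat_Suc)
      finally have n: "real n \<le> norm (sqrt_branch z) ^ (r - q) * norm w ^ (r - q)" .
      have "w ^ r = w ^ (r - q) * w ^ q" using assms(2) by (simp flip: power_add)
      then have "gl_deriv_leading r z n = w ^ (r - q) * gl_deriv_leading q z n"
        unfolding gl_deriv_leading_def w_def by (simp only: mult.assoc)
      then have eq: "norm (sqrt_branch z) ^ (r - q) * norm (gl_deriv_leading r z n) =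
          norm (sqrt_branch z) ^ (r - q) * norm w ^ (r - q) * norm (gl_deriv_leading q z n)"
        by (simp only: norm_mult norm_power mult.assoc)
      show "norm (of_nat n * gl_deriv_leading q z n) \<le>
          norm (sqrt_branch z) ^ (r - q) * norm (gl_deriv_leading r z n)"
        unfolding eq norm_mult norm_of_nat by (rule mult_right_mono[OF n]) simp
    qed
  qed
  moreover have "(\<lambda>n. of_nat n * (deriv ^^ q) (gl_rem_fun n) z) \<in>
      O(\<lambda>n. of_nat n * gl_deriv_leading q z n)"
    using T[of q] by (intro landau_o.big.mult landau_o.big_refl bigthetaD1)
  ultimately show ?thesis
    using bigthetaD1[OF T[of r, unfolded bigtheta_sym[of "\<lambda>n. (deriv ^^ r) (gl_rem_fun n) z"]]]
    by (meson landau_o.big_trans)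
qed

text \<open>
  The contribution \<open>L\<^sub>n\<close> of the derivatives below the highest one is \<open>O(|K\<^sub>n| / n)\<close>, hence
  negligible against the relevant part of \<open>K\<^sub>n\<close> along the filter.
\<close>
lemma gl_remainder_asymp_along_filter:
  fixes a b :: real
  assumes p: "p \<ge> 1" and b: "b > 0"
  defines "z0 \<equiv> Complex a b"
  assumes F: "F \<le> sequentially"
    and small: "(\<lambda>n. norm ((deriv ^^ (p - 1)) (gl_rem_fun n) z0)) \<in>
          o[F](\<lambda>n. real n * gl_part p ((deriv ^^ (p - 1)) (gl_rem_fun n) z0))"
  shows "(\<lambda>n. \<bar>gl_remainder n (\<lambda>x. 1 / ((x - a)\<^sup>2 + b\<^sup>2) ^ p)\<bar>) \<sim>[F]
        (\<lambda>n. 2 / (fact (p - 1) * (2 * b) ^ p) *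
               gl_part p ((deriv ^^ (p - 1)) (gl_rem_fun n) z0))"
proof -
  obtain C where C: "C (p - 1) = 2 / ((2 * \<i> * of_real b) ^ p * fact (p - 1))"
    and R: "\<And>n. gl_remainder n (\<lambda>x. 1 / ((x - a)\<^sup>2 + b\<^sup>2) ^ p) =
           - Re (\<Sum>q<p. C q * (deriv ^^ q) (gl_rem_fun n) z0)"
    by (rule gl_remainder_expansion[OF p b, of a, folded z0_def]) (rule that)
  have z0: "z0 \<notin> slit" unfolding z0_def by (rule Complex_not_slit[OF b])
  define K where "K n = (deriv ^^ (p - 1)) (gl_rem_fun n) z0" for n
  define T where "T n = 2 / (fact (p - 1) * (2 * b) ^ p) * gl_part p (K n)" for n
  define L where "L n = (\<Sum>q<p - 1. C q * (deriv ^^ q) (gl_rem_fun n) z0)" for n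
  have T: "T n = \<bar>Re (C (p - 1) * K n)\<bar>" for n
    unfolding T_def C gl_part_scale[OF b] ..
  have split: "(\<Sum>q<p. C q * (deriv ^^ q) (gl_rem_fun n) z0) = L n + C (p - 1) * K n" for n
    using p by (cases p) (simp_all add: L_def K_def)
  have diff: "\<bar>\<bar>gl_remainder n (\<lambda>x. 1 / ((x - a)\<^sup>2 + b\<^sup>2) ^ p)\<bar> - T n\<bar> \<le> norm (L n)" for n
  proof -
    have "gl_remainder n (\<lambda>x. 1 / ((x - a)\<^sup>2 + b\<^sup>2) ^ p) = - (Re (L n) + Re (C (p - 1) * K n))"
      unfolding R split by simp
    then show ?thesis unfolding T using abs_Re_le_cmod[of "L n"] by linarith
  qed
  have "(\<lambda>n. of_nat n * L n) \<in> O(K)"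
  proof -
    have "(\<lambda>n. \<Sum>q<p - 1. C q * (of_nat n * (deriv ^^ q) (gl_rem_fun n) z0)) \<in> O(K)"
      unfolding K_def using gl_deriv_lower_order[OF z0]
      by (intro big_sum_in_bigo) simp
    then show ?thesis by (simp add: L_def sum_distrib_left mult_ac)
  qed
  then obtain c where c: "c > 0" "\<forall>\<^sub>F n in sequentially. norm (of_nat n * L n) \<le> c * norm (K n)"
    by (elim landau_o.bigE)
  have "(\<lambda>n. \<bar>gl_remainder n (\<lambda>x. 1 / ((x - a)\<^sup>2 + b\<^sup>2) ^ p)\<bar> - T n) \<in> o[F](\<lambda>n. gl_part p (K n))"
  proof (rule landau_o.smallI)
    fix \<epsilon> :: real assume \<epsilon>: "\<epsilon> > 0"
    have "\<forall>\<^sub>F n in F. norm (of_nat n * L n) \<le> c * norm (K n)"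
      using filter_leD[OF F c(2)] .
    moreover have "\<forall>\<^sub>F n in F. norm (norm (K n)) \<le> \<epsilon> / c * norm (real n * gl_part p (K n))"
      using landau_o.smallD[OF small, of "\<epsilon> / c"] \<epsilon> c(1) by (simp add: K_def)
    moreover have "\<forall>\<^sub>F n in F. n \<ge> 1"
      using filter_leD[OF F eventually_ge_at_top[of 1]] .
    ultimately show "\<forall>\<^sub>F n in F. norm (\<bar>gl_remainder n (\<lambda>x. 1 / ((x - a)\<^sup>2 + b\<^sup>2) ^ p)\<bar> - T n) \<le>
        \<epsilon> * norm (gl_part p (K n))"
    proof eventually_elim
      case (elim n)
      have "real n * norm (L n) \<le> c * norm (K n)" using elim(1) by (simp add: norm_mult)
      also have "\<dots> \<le> c * (\<epsilon> / c * (real n * norm (gl_part p (K n))))"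
        using elim(2) c(1) by (intro mult_left_mono) (simp_all add: abs_mult)
      also have "\<dots> = real n * (\<epsilon> * norm (gl_part p (K n)))" using c(1) by simp
      finally have "norm (L n) \<le> \<epsilon> * norm (gl_part p (K n))" using elim(3) by simp
      then show ?case using diff[of n] by simp
    qed
  qed
  also have "(\<lambda>n. gl_part p (K n)) \<in> O[F](T)"
    unfolding T_def using b by (intro bigoI[of _ "fact (p - 1) * (2 * b) ^ p / 2"]) (simp add: abs_mult)
  finally show ?thesis
    unfolding T_def K_def by (rule smallo_imp_asymp_equiv)
qed

lemma gl_remainder_asymp_simple_pole:
  fixes a b :: real
  assumes b: "b > 0"
  shows "\<bar>gl_remainder n (\<lambda>x. 1 / ((x - a)\<^sup>2 + b\<^sup>2) ^ 1)\<bar> =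
     2 / (fact 0 * (2 * b) ^ 1) * gl_part 1 (gl_rem_fun n (Complex a b))"
proof -
  obtain C where C: "C 0 = 2 / ((2 * \<i> * of_real b) ^ 1 * fact (1 - 1))"
    and R: "\<And>n. gl_remainder n (\<lambda>x. 1 / ((x - a)\<^sup>2 + b\<^sup>2) ^ 1) =
           - Re (\<Sum>q<1. C q * (deriv ^^ q) (gl_rem_fun n) (Complex a b))"
    by (rule gl_remainder_expansion[OF order_refl b, of a]) simp
  show ?thesis
    unfolding R using gl_part_scale[OF b, of 1 "gl_rem_fun n (Complex a b)"] C by simp
qed

text \<open>
  For \<open>z\<^sub>0 = i b\<close> both \<open>\<surd>(z\<^sub>0\<^sup>2 - 1)\<close> and \<open>u\<close> are purely imaginary. The leading term \<open>G\<^sub>n\<close> of the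
  derivative of order \<open>p - 1\<close> contains \<open>p - 1\<close> factors of the first and \<open>2n+1\<close> of the second kind, so
  that \<open>G\<^sub>n / i\<^sup>p\<close> is real. Hence the part of \<open>K\<^sub>n\<close> that enters is comparable to \<open>|K\<^sub>n|\<close>: there is no
  cancellation by rotation of the phase.
\<close>
lemma gl_part_dominates_imaginary_axis:
  fixes b :: real
  assumes p: "p \<ge> 1" and b: "b > 0"
  defines "K \<equiv> \<lambda>n. (deriv ^^ (p - 1)) (gl_rem_fun n) (Complex 0 b)"
  shows "(\<lambda>n. norm (K n)) \<in> o(\<lambda>n. real n * gl_part p (K n))"
proof -
  define z0 where "z0 = Complex 0 b"
  define G where "G = gl_deriv_leading (p - 1) z0"
  have z0: "z0 \<notin> slit" unfolding z0_def by (rule Complex_not_slit[OF b])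
  have KG: "K \<sim>[sequentially] G"
    unfolding K_def G_def z0_def[symmetric] by (rule higher_deriv_gl_rem_fun_asymp[OF z0])
  have G0: "G n \<noteq> 0" for n unfolding G_def by (rule gl_deriv_leading_nonzero[OF z0])
  have real: "G n / \<i> ^ p \<in> \<real>" for n
  proof -
    define \<sigma> where "\<sigma> = b * sqrt (1 + 1 / b\<^sup>2)"
    have z0_eq: "z0 = \<i> * of_real b" by (simp add: z0_def complex_eq_iff)
    have "1 - 1 / z0\<^sup>2 = complex_of_real (1 + 1 / b\<^sup>2)"
      by (simp add: z0_eq power_mult_distrib)
    then have "csqrt (1 - 1 / z0\<^sup>2) = of_real (sqrt (1 + 1 / b\<^sup>2))"
      by (simp only: csqrt_of_real_nonneg) (simp add: csqrt_of_real_nonneg del: of_real_add)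
    then have s: "sqrt_branch z0 = \<i> * of_real \<sigma>"
      unfolding sqrt_branch_eq_csqrt[OF z0] by (simp add: z0_eq \<sigma>_def)
    have u: "z0 + sqrt_branch z0 = \<i> * of_real (b + \<sigma>)"
      unfolding s by (simp add: z0_eq ring_distribs)
    obtain k where k: "p = Suc k" using p by (cases p) auto
    have "- (of_nat (2 * n + 1) / (\<i> * of_real \<sigma>)) = \<i> * complex_of_real (real (2 * n + 1) / \<sigma>)"
      by (simp add: divide_complex_def)
    then have "G n / \<i> ^ p = (\<i> * of_real (real (2 * n + 1) / \<sigma>)) ^ k * (2 * of_real pi / (\<i> *
        of_real (b + \<sigma>)) ^ (2 * n + 1)) / \<i> ^ Suc k"
      unfolding G_def gl_deriv_leading_def u by (simp add: s k)
    also have "\<dots> = of_real ((real (2 * n + 1) / \<sigma>) ^ k * (2 * pi) / (b + \<sigma>) ^ (2 * n + 1)) / (\<i> ^ (2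
        * n + 1) * \<i>)"
    proof -
      have "(J * A) * (t / (M * V)) / (\<i> * J) = A * t / V / (M * \<i>)" if "J \<noteq> 0" for J A t M V :: complex
        using that by (simp add: mult_ac)
      from this[of "\<i> ^ k"] show ?thesis
        unfolding power_mult_distrib power_Suc by simp
    qed
    also have "\<i> ^ (2 * n + 1) * \<i> = of_real (- ((-1) ^ n))"
    proof -
      have "\<i> ^ (2 * n + 1) * \<i> = (\<i> ^ 2) ^ n * (\<i> * \<i>)"
        by (simp only: power_add power_mult power_one_right mult.assoc)
      then show ?thesis by simp
    qed
    finally show ?thesis by (simp only: of_real_divide[symmetric] Reals_of_real)
  qed
  have lim: "(\<lambda>n. K n / G n) \<longlonglongrightarrow> 1"
    using KG G0 by (simp add: asymp_equiv_def)
  have part: "gl_part p (K n) = \<bar>Re (K n / G n)\<bar> * norm (G n)" for n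
  proof -
    obtain g where g: "G n / \<i> ^ p = of_real g" using real[of n] by (elim Reals_cases)
    have "K n / \<i> ^ p = K n / G n * of_real g" unfolding g[symmetric] using G0[of n] by simp
    moreover have "Re (w * of_real g) = Re w * g" for w by simp
    ultimately have "Re (K n / \<i> ^ p) = Re (K n / G n) * g" by (simp only:)
    moreover have "\<bar>g\<bar> = norm (G n)"
      using arg_cong[OF g, of norm] by (simp add: norm_divide norm_power)
    ultimately show ?thesis by (simp add: gl_part_eq_Re abs_mult)
  qed
  have "(\<lambda>n. Re (K n / G n)) \<longlonglongrightarrow> 1" using tendsto_Re[OF lim] by simp
  then have ev1: "\<forall>\<^sub>F n in sequentially. Re (K n / G n) > 1 / 2" by (rule order_tendstoD) simp
  have "(\<lambda>n. norm (K n / G n)) \<longlonglongrightarrow> 1" using tendsto_norm[OF lim] by simp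
  then have ev2: "\<forall>\<^sub>F n in sequentially. norm (K n / G n) < 2" by (rule order_tendstoD) simp
  have "(\<lambda>n. norm (K n)) \<in> O(\<lambda>n. gl_part p (K n))"
  proof (rule bigoI)
    show "\<forall>\<^sub>F n in sequentially. norm (norm (K n)) \<le> 4 * norm (gl_part p (K n))"
      using ev1 ev2
    proof eventually_elim
      case (elim n)
      have "norm (K n) = norm (K n / G n) * norm (G n)" using G0[of n] by (simp add: norm_divide)
      also have "\<dots> \<le> 4 * \<bar>Re (K n / G n)\<bar> * norm (G n)"
        using elim by (intro mult_right_mono) auto
      finally show ?case by (simp add: part abs_mult)
    qed
  qed
  also have "(\<lambda>n. 1 * gl_part p (K n)) \<in> o(\<lambda>n. real n * gl_part p (K n))"
  proof (rule landau_o.small_big_mult)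
    show "(\<lambda>n. 1) \<in> o(\<lambda>n. real n)" by real_asymp
  qed simp
  then have "(\<lambda>n. gl_part p (K n)) \<in> o(\<lambda>n. real n * gl_part p (K n))" by simp
  finally show ?thesis .
qed

theorem theorem2:
  fixes p :: nat and a b :: real and g :: "real \<Rightarrow> real" and z0 :: complex
  assumes p: "p \<ge> 1" and b: "b > 0"
    and g: "g = (\<lambda>x. 1 / ((x - a)\<^sup>2 + b\<^sup>2) ^ p)"
    and z0: "z0 = Complex a b"
  shows
    "(p = 1 \<or> a = 0 \<longrightarrow>
        (\<lambda>n. \<bar>gl_remainder n g\<bar>) \<sim>[sequentially]
        (\<lambda>n. 2 / (fact (p - 1) * (2 * b) ^ p) *
               gl_part p ((deriv ^^ (p - 1)) (gl_rem_fun n) z0)))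
     \<and>
     (\<forall>F. F \<le> sequentially \<and>
        (\<lambda>n. norm ((deriv ^^ (p - 1)) (gl_rem_fun n) z0)) \<in>
          o[F](\<lambda>n. real n * gl_part p ((deriv ^^ (p - 1)) (gl_rem_fun n) z0)) \<longrightarrow>
        (\<lambda>n. \<bar>gl_remainder n g\<bar>) \<sim>[F]
        (\<lambda>n. 2 / (fact (p - 1) * (2 * b) ^ p) *
               gl_part p ((deriv ^^ (p - 1)) (gl_rem_fun n) z0)))
     \<and>
     (\<forall>q z. z \<notin> closed_segment (-1) (1::complex) \<longrightarrow>
        (\<lambda>n. (deriv ^^ q) (gl_rem_fun n) z) \<sim>[sequentially]
        (\<lambda>n. (- (of_nat (2 * n + 1) / sqrt_branch z)) ^ q *
               (2 * of_real pi / (z + sqrt_branch z) ^ (2 * n + 1))))"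
proof (intro conjI allI impI)
  assume "p = 1 \<or> a = 0"
  then show "(\<lambda>n. \<bar>gl_remainder n g\<bar>) \<sim>[sequentially]
        (\<lambda>n. 2 / (fact (p - 1) * (2 * b) ^ p) *
               gl_part p ((deriv ^^ (p - 1)) (gl_rem_fun n) z0))"
  proof
    assume "p = 1"
    then show ?thesis
      using gl_remainder_asymp_simple_pole[OF b, of _ a] unfolding g z0 by simp
  next
    assume "a = 0"
    then show ?thesis
      unfolding g z0
      using gl_part_dominates_imaginary_axis[OF p b]
      by (intro gl_remainder_asymp_along_filter p b) auto
  qed
next
  fix F
  assume "F \<le> sequentially \<and> (\<lambda>n. norm ((deriv ^^ (p - 1)) (gl_rem_fun n) z0)) \<in>
          o[F](\<lambda>n. real n * gl_part p ((deriv ^^ (p - 1)) (gl_rem_fun n) z0))"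
  then show "(\<lambda>n. \<bar>gl_remainder n g\<bar>) \<sim>[F]
        (\<lambda>n. 2 / (fact (p - 1) * (2 * b) ^ p) *
               gl_part p ((deriv ^^ (p - 1)) (gl_rem_fun n) z0))"
    unfolding g z0 by (intro gl_remainder_asymp_along_filter p b) auto
next
  fix q and z :: complex
  assume "z \<notin> closed_segment (-1) 1"
  from higher_deriv_gl_rem_fun_asymp[OF this]
  show "(\<lambda>n. (deriv ^^ q) (gl_rem_fun n) z) \<sim>[sequentially]
        (\<lambda>n. (- (of_nat (2 * n + 1) / sqrt_branch z)) ^ q *
               (2 * of_real pi / (z + sqrt_branch z) ^ (2 * n + 1)))"
    unfolding gl_deriv_leading_def[abs_def] .
qed

end
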